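(* Let $G=A_5\times\langle a\rangle$ with $|a|=2$ and let $\mathcal M=\mathcal M(G;r_0,r_1,r_2)$ be a regular linear hypermap. If $\mathcal M$ is orientable, then $\mathcal M$ is isomorphic to one of: (1) $\mathcal M(G;(12)(35)a,(12)(34)a,(13)(24)a)$, $\mathcal M$-sequence $[0;2,5,3;30,12,20;120]$; (2) $\mathcal M(G;(12)(35)a,(13)(24)a,(12)(34)a)$, $[0;2,3,5;30,20,12;120]$; (3) $\mathcal M(G;(14)(25)a,(12)(34)a,(13)(24)a)$, $[4;2,5,5;30,12,12;120]$; (4) $\mathcal M(G;(14)(35)a,(12)(45)a,(13)(45)a)$, $[0;3,2,5;20,30,12;120]$; (5) $\mathcal M(G;(13)(24)a,(12)(45)a,(13)(45)a)$, $[5;3,3,5;20,20,12;120]$; (6) $\mathcal M(G;(14)(35)a,(14)(23)a,(13)(45)a)$, $[0;5,2,3;12,30,20;120]$; (7) $\mathcal M(G;(15)(34)a,(14)(23)a,(13)(45)a)$, $[4;5,2,5;12,30,12;120]$. If $\mathcal M$ is non-orientable, then $\mathcal M$ is isomorphic to one of: (8) $\mathcal M(G;(12)(35),(12)(34)a,(14)(23))$, $[10;2,5,6;30,12,10;120]$; (9) $\mathcal M(G;(12)(35),(13)(24)a,(14)(23))$, $[14;2,5,10;30,12,6;120]$; (10) $\mathcal M(G;(12)(35)a,(14)(23),(12)(34)a)$, $[6;2,3,10;30,20,6;120]$; (11) $\mathcal M(G;(12)(35)a,(14)(23),(13)(24)a)$, $[14;2,5,10;30,12,6;120]$; (12) $\mathcal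 M(G;(14)(25),(12)(34)a,(14)(23))$, $[6;2,3,10;30,20,6;120]$; (13) $\mathcal M(G;(14)(25)a,(14)(23),(12)(34)a)$, $[10;2,5,6;30,12,10;120]$; (14) $\mathcal M(G;(14)(35)a,(12)(45),(13)(45))$, $[6;3,2,10;20,30,6;120]$; (15) $\mathcal M(G;(14)(35),(12)(45)a,(13)(45)a)$, $[6;3,2,10;20,30,6;120]$; (16) $\mathcal M(G;(14)(35)a,(14)(23),(13)(45))$, $[10;5,2,6;12,30,10;120]$; (17) $\mathcal M(G;(15)(34)a,(14)(23),(13)(45))$, $[14;5,2,10;12,30,6;120]$; (18) $\mathcal M(G;(14)(35),(14)(23)a,(13)(45)a)$, $[10;5,2,6;12,30,10;120]$; (19) $\mathcal M(G;(15)(34),(14)(23)a,(13)(45)a)$, $[14;5,2,10;12,30,6;120]$.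
   Context: $A_5$ acts on $\{1,\dots,5\}$, elements written in disjoint cycle notation; $a$ generates the direct factor of order 2. Let $G$ be a finite group and $r_0,r_1,r_2\in G$ pairwise distinct involutions with $G=\langle r_0,r_1,r_2\rangle$. $\mathcal M(G;r_0,r_1,r_2)$ is a regular linear hypermap if (1) $\langle r_1,r_2\rangle\cap\langle r_0,r_2\rangle=\langle r_2\rangle$ and (2) $\langle r_1,r_2\rangle\langle r_0,r_2\rangle\cap\langle r_0,r_2\rangle\langle r_1,r_2\rangle=\langle r_1,r_2\rangle\cup\langle r_0,r_2\rangle$. Flags are elements of $G$ with $r_i$ acting by right multiplication; isomorphism of $\mathcal M(G;r_i)$, $\mathcal M(G';s_i)$ means a bijection $\sigma:G\to G'$ with $(xr_i)^\sigma=x^\sigma s_i$. Numbers of vertices, hyperedges, hyperfaces: $V=|G|/|\langle r_1,r_2\rangle|$, $E=|G|/|\langle r_0,r_2\rangle|$, $F=|G|/|\langle r_0,r_1\rangle|$. Type $(k,m,n)=(|r_1r_2|,|r_0r_2|,|r_0r_1|)$. $\mathcal M$ is non-orientable if $G=\langle r_0r_2,r_1r_2\rangle$, orientable otherwise; genus $g$ given by $V+E+F-|G|/2=2-2g$ (orientable) or $2-g$ (non-orientable). The $\mathcal M$-sequence is $[g;k,m,n;V,E,F;|G|]$. *)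

theory Defs
  imports "HOL-Algebra.Algebra"
begin

text \<open>
  A regular hypermap \<open>M(G; r0, r1, r2)\<close> is given by a group \<open>G\<close> and three elements of it; the
  flags are the elements of \<open>G\<close>, on which \<open>r0\<close>, \<open>r1\<close>, \<open>r2\<close> act by right multiplication.
\<close>

definition involution :: "('a, 'm) monoid_scheme \<Rightarrow> 'a \<Rightarrow> bool" where
  "involution G x \<longleftrightarrow> x \<in> carrier G \<and> group.ord G x = 2"

definition regular_linear_hypermap ::
    "('a, 'm) monoid_scheme \<Rightarrow> 'a \<Rightarrow> 'a \<Rightarrow> 'a \<Rightarrow> bool" where
  "regular_linear_hypermap G r0 r1 r2 \<longleftrightarrow>
     group G \<and> finite (carrier G) \<and>
     involution G r0 \<and> involution G r1 \<and> involution G r2 \<and>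
     r0 \<noteq> r1 \<and> r0 \<noteq> r2 \<and> r1 \<noteq> r2 \<and>
     generate G {r0, r1, r2} = carrier G \<and>
     generate G {r1, r2} \<inter> generate G {r0, r2} = generate G {r2} \<and>
     (generate G {r1, r2} <#>\<^bsub>G\<^esub> generate G {r0, r2}) \<inter>
       (generate G {r0, r2} <#>\<^bsub>G\<^esub> generate G {r1, r2}) =
       generate G {r1, r2} \<union> generate G {r0, r2}"

definition hypermap_isomorphic ::
    "('a, 'm) monoid_scheme \<Rightarrow> 'a \<times> 'a \<times> 'a \<Rightarrow>
     ('b, 'n) monoid_scheme \<Rightarrow> 'b \<times> 'b \<times> 'b \<Rightarrow> bool" where
  "hypermap_isomorphic G = (\<lambda>(r0, r1, r2) H (s0, s1, s2).
     (\<exists>\<sigma>. bij_betw \<sigma> (carrier G) (carrier H) \<and>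
        (\<forall>x \<in> carrier G.
           \<sigma> (x \<otimes>\<^bsub>G\<^esub> r0) = \<sigma> x \<otimes>\<^bsub>H\<^esub> s0 \<and>
           \<sigma> (x \<otimes>\<^bsub>G\<^esub> r1) = \<sigma> x \<otimes>\<^bsub>H\<^esub> s1 \<and>
           \<sigma> (x \<otimes>\<^bsub>G\<^esub> r2) = \<sigma> x \<otimes>\<^bsub>H\<^esub> s2)))"

definition orientable :: "('a, 'm) monoid_scheme \<Rightarrow> 'a \<Rightarrow> 'a \<Rightarrow> 'a \<Rightarrow> bool" where
  "orientable G r0 r1 r2 \<longleftrightarrow>
     generate G {r0 \<otimes>\<^bsub>G\<^esub> r2, r1 \<otimes>\<^bsub>G\<^esub> r2} \<noteq> carrier G"

text \<open>The divisions below are exact for finite groups, by Lagrange's theorem.\<close>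

definition num_vertices :: "('a, 'm) monoid_scheme \<Rightarrow> 'a \<Rightarrow> 'a \<Rightarrow> 'a \<Rightarrow> nat" where
  "num_vertices G r0 r1 r2 = order G div card (generate G {r1, r2})"

definition num_hyperedges :: "('a, 'm) monoid_scheme \<Rightarrow> 'a \<Rightarrow> 'a \<Rightarrow> 'a \<Rightarrow> nat" where
  "num_hyperedges G r0 r1 r2 = order G div card (generate G {r0, r2})"

definition num_hyperfaces :: "('a, 'm) monoid_scheme \<Rightarrow> 'a \<Rightarrow> 'a \<Rightarrow> 'a \<Rightarrow> nat" where
  "num_hyperfaces G r0 r1 r2 = order G div card (generate G {r0, r1})"

definition euler_char :: "('a, 'm) monoid_scheme \<Rightarrow> 'a \<Rightarrow> 'a \<Rightarrow> 'a \<Rightarrow> rat" where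
  "euler_char G r0 r1 r2 =
     of_nat (num_vertices G r0 r1 r2) + of_nat (num_hyperedges G r0 r1 r2)
       + of_nat (num_hyperfaces G r0 r1 r2) - of_nat (order G) / 2"

text \<open>
  The genus \<open>g\<close> solves \<open>\<chi> = 2 - 2 g\<close> (orientable) or \<open>\<chi> = 2 - g\<close> (non-orientable), where \<open>\<chi>\<close> is
  the Euler characteristic. It is taken in the rationals so that no rounding can occur.
\<close>

definition hypermap_genus :: "('a, 'm) monoid_scheme \<Rightarrow> 'a \<Rightarrow> 'a \<Rightarrow> 'a \<Rightarrow> rat" where
  "hypermap_genus G r0 r1 r2 =
     (if orientable G r0 r1 r2 then (2 - euler_char G r0 r1 r2) / 2
      else 2 - euler_char G r0 r1 r2)"

type_synonym hypermap_seq = "rat \<times> (nat \<times> nat \<times> nat) \<times> (nat \<times> nat \<times> nat) \<times> nat"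

text \<open>The sequence \<open>[g; k, m, n; V, E, F; |G|]\<close>.\<close>

definition M_sequence :: "('a, 'm) monoid_scheme \<Rightarrow> 'a \<Rightarrow> 'a \<Rightarrow> 'a \<Rightarrow> hypermap_seq" where
  "M_sequence G r0 r1 r2 =
     (hypermap_genus G r0 r1 r2,
      (group.ord G (r1 \<otimes>\<^bsub>G\<^esub> r2), group.ord G (r0 \<otimes>\<^bsub>G\<^esub> r2), group.ord G (r0 \<otimes>\<^bsub>G\<^esub> r1)),
      (num_vertices G r0 r1 r2, num_hyperedges G r0 r1 r2, num_hyperfaces G r0 r1 r2),
      order G)"

text \<open>
  The permutation \<open>(i j)(k l)\<close>. Products in \<^const>\<open>alt_group\<close> are compositions of functions, applied
  from right to left. The opposite convention yields the same notions: it replaces a group by its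
  opposite group, inversion identifies the two, and inversion fixes involutions.
\<close>

definition dt :: "nat \<Rightarrow> nat \<Rightarrow> nat \<Rightarrow> nat \<Rightarrow> nat \<Rightarrow> nat" where
  "dt i j k l = transpose i j \<circ> transpose k l"

text \<open>
  In the lists below, \<open>a\<close> is to be the generator of the second direct factor and \<open>e\<close> its neutral
  element, so that \<open>(dt i j k l, a)\<close> stands for \<open>(i j)(k l) a\<close> and \<open>(dt i j k l, e)\<close> for
  \<open>(i j)(k l)\<close>.
\<close>

type_synonym 'c triple = "((nat \<Rightarrow> nat) \<times> 'c) \<times> ((nat \<Rightarrow> nat) \<times> 'c) \<times> ((nat \<Rightarrow> nat) \<times> 'c)"

definition orientable_list :: "'c \<Rightarrow> ('c triple \<times> hypermap_seq) list" where
  "orientable_list a =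
   [(((dt 1 2 3 5, a), (dt 1 2 3 4, a), (dt 1 3 2 4, a)), (0, (2, 5, 3), (30, 12, 20), 120)),
    (((dt 1 2 3 5, a), (dt 1 3 2 4, a), (dt 1 2 3 4, a)), (0, (2, 3, 5), (30, 20, 12), 120)),
    (((dt 1 4 2 5, a), (dt 1 2 3 4, a), (dt 1 3 2 4, a)), (4, (2, 5, 5), (30, 12, 12), 120)),
    (((dt 1 4 3 5, a), (dt 1 2 4 5, a), (dt 1 3 4 5, a)), (0, (3, 2, 5), (20, 30, 12), 120)),
    (((dt 1 3 2 4, a), (dt 1 2 4 5, a), (dt 1 3 4 5, a)), (5, (3, 3, 5), (20, 20, 12), 120)),
    (((dt 1 4 3 5, a), (dt 1 4 2 3, a), (dt 1 3 4 5, a)), (0, (5, 2, 3), (12, 30, 20), 120)),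
    (((dt 1 5 3 4, a), (dt 1 4 2 3, a), (dt 1 3 4 5, a)), (4, (5, 2, 5), (12, 30, 12), 120))]"

definition nonorientable_list :: "'c \<Rightarrow> 'c \<Rightarrow> ('c triple \<times> hypermap_seq) list" where
  "nonorientable_list e a =
   [(((dt 1 2 3 5, e), (dt 1 2 3 4, a), (dt 1 4 2 3, e)), (10, (2, 5, 6), (30, 12, 10), 120)),
    (((dt 1 2 3 5, e), (dt 1 3 2 4, a), (dt 1 4 2 3, e)), (14, (2, 5, 10), (30, 12, 6), 120)),
    (((dt 1 2 3 5, a), (dt 1 4 2 3, e), (dt 1 2 3 4, a)), (6, (2, 3, 10), (30, 20, 6), 120)),
    (((dt 1 2 3 5, a), (dt 1 4 2 3, e), (dt 1 3 2 4, a)), (14, (2, 5, 10), (30, 12, 6), 120)),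
    (((dt 1 4 2 5, e), (dt 1 2 3 4, a), (dt 1 4 2 3, e)), (6, (2, 3, 10), (30, 20, 6), 120)),
    (((dt 1 4 2 5, a), (dt 1 4 2 3, e), (dt 1 2 3 4, a)), (10, (2, 5, 6), (30, 12, 10), 120)),
    (((dt 1 4 3 5, a), (dt 1 2 4 5, e), (dt 1 3 4 5, e)), (6, (3, 2, 10), (20, 30, 6), 120)),
    (((dt 1 4 3 5, e), (dt 1 2 4 5, a), (dt 1 3 4 5, a)), (6, (3, 2, 10), (20, 30, 6), 120)),
    (((dt 1 4 3 5, a), (dt 1 4 2 3, e), (dt 1 3 4 5, e)), (10, (5, 2, 6), (12, 30, 10), 120)),
    (((dt 1 5 3 4, a), (dt 1 4 2 3, e), (dt 1 3 4 5, e)), (14, (5, 2, 10), (12, 30, 6), 120)),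
    (((dt 1 4 3 5, e), (dt 1 4 2 3, a), (dt 1 3 4 5, a)), (10, (5, 2, 6), (12, 30, 10), 120)),
    (((dt 1 5 3 4, e), (dt 1 4 2 3, a), (dt 1 3 4 5, a)), (14, (5, 2, 10), (12, 30, 6), 120))]"

end

theory Submission
  imports Defs
begin

text \<open>
  All objects are transported to a model of \<open>A5 \<times> C2\<close> that can be computed with. Up to conjugation in
  \<open>S5\<close> the component of \<open>r2\<close> in \<open>A5\<close> is trivial or \<open>(12)(34)\<close>, so finitely many triples remain. A
  triple fails to generate when its components in \<open>A5\<close> all preserve a point, a pair or a pentagon, or
  when all its components in \<open>C2\<close> are trivial. Any other triple either violates linearity, because of an
  explicit element of \<open>HK \<inter> KH\<close> outside \<open>H \<union> K\<close>, where \<open>H\<close> and \<open>K\<close> are generated by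
  \<open>r1, r2\<close> and by \<open>r0, r2\<close>, or of \<open>H \<inter> K\<close> outside \<open>{1, r2}\<close>, or it is conjugate to a
  listed triple. That the listed triples generate is certified by words, and subgroups
  generated by two involutions are listed as alternating words.
\<close>

section \<open>Subgroups generated by involutions\<close>

text \<open>Letters are added on the left, \<open>y\<close> first, so the word of length 2n is the
  n-th power of \<open>x y\<close>. The operation is a parameter, so that one definition serves both
  abstract groups and evaluation.\<close>

primrec alt_word :: "('a \<Rightarrow> 'a \<Rightarrow> 'a) \<Rightarrow> 'a \<Rightarrow> 'a \<Rightarrow> 'a \<Rightarrow> nat \<Rightarrow> 'a" where
  "alt_word m e x y 0 = e"
| "alt_word m e x y (Suc n) = m (if even n then y else x) (alt_word m e x y n)"

primrec alt_words :: "('a \<Rightarrow> 'a \<Rightarrow> 'a) \<Rightarrow> 'a \<Rightarrow> 'a \<Rightarrow> 'a \<Rightarrow> nat \<Rightarrow> 'a list" where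
  "alt_words m w x y 0 = []"
| "alt_words m w x y (Suc n) = w # alt_words m (m y w) y x n"

text \<open>The start index is general for the sake of the induction; its parity tells which letter
  comes next.\<close>

lemma alt_words_eq_map:
  "alt_words m (alt_word m e x y i) (if even i then x else y) (if even i then y else x) n =
     map (alt_word m e x y) [i..<i + n]"
proof (induction n arbitrary: i)
  case (Suc n)
  have "[i..<i + Suc n] = i # [Suc i..<Suc i + n]" by (simp add: upt_conv_Cons del: upt_Suc)
  then show ?case using Suc[of "Suc i"] by (cases "even i") (simp_all del: upt_Suc)
qed simp

primrec pow_word :: "('a \<Rightarrow> 'a \<Rightarrow> 'a) \<Rightarrow> 'a \<Rightarrow> 'a \<Rightarrow> nat \<Rightarrow> 'a" where
  "pow_word m e u 0 = e"
| "pow_word m e u (Suc n) = m u (pow_word m e u n)"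

text \<open>The generators swap at each exponent, so a word in two generators is just a list of
  exponents; a leading 0 lets it begin with \<open>v\<close>.\<close>

primrec word :: "('a \<Rightarrow> 'a \<Rightarrow> 'a) \<Rightarrow> 'a \<Rightarrow> 'a \<Rightarrow> 'a \<Rightarrow> nat list \<Rightarrow> 'a" where
  "word m e u v [] = e"
| "word m e u v (n # ns) = m (pow_word m e u n) (word m e v u ns)"

text \<open>Elements whose left multiplication maps \<open>W\<close> into itself are closed under
  products, and inverses add nothing because the generators are involutions. Applied to the
  identity, such an element lands in \<open>W\<close>.\<close>

lemma (in group) generate_subset_if_left_closed:
  assumes "S \<subseteq> carrier G" "\<And>s. s \<in> S \<Longrightarrow> s \<otimes> s = \<one>"
    and "W \<subseteq> carrier G" "\<one> \<in> W" "\<And>s w. s \<in> S \<Longrightarrow> w \<in> W \<Longrightarrow> s \<otimes> w \<in> W"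
  shows "generate G S \<subseteq> W"
proof
  fix g assume g: "g \<in> generate G S"
  have "g \<in> carrier G \<and> (\<forall>w\<in>W. g \<otimes> w \<in> W)"
    using g
  proof (induction rule: generate.induct)
    case one
    then show ?case using assms(3) by auto
  next
    case (incl h)
    then show ?case using assms by auto
  next
    case (inv h)
    then have "inv h = h" using assms(1,2) by (intro inv_equality) auto
    with inv show ?case using assms by auto
  next
    case (eng h1 h2)
    then show ?case using assms(3) by (auto simp: m_assoc subset_iff)
  qed
  with assms(4) show "g \<in> W" by (metis r_one)
qed

lemma (in group) ord_eq_2_iff:
  assumes "x \<in> carrier G"
  shows "ord x = 2 \<longleftrightarrow> x \<noteq> \<one> \<and> x \<otimes> x = \<one>"
proof -
  have "x \<otimes> x = \<one> \<longleftrightarrow> ord x dvd 2"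
    using pow_eq_id[OF assms, of 2] assms by (simp add: numeral_2_eq_2)
  also have "\<dots> \<longleftrightarrow> ord x = 1 \<or> ord x = 2"
    using prime_nat_iff two_is_prime_nat by auto
  finally show ?thesis using ord_eq_1[OF assms] by auto
qed

lemma (in group) generate_involution:
  assumes "x \<in> carrier G" "x \<otimes> x = \<one>"
  shows "generate G {x} = {\<one>, x}"
proof
  show "generate G {x} \<subseteq> {\<one>, x}"
    using assms by (intro generate_subset_if_left_closed) auto
qed (auto intro: generate.one generate.incl)

lemma (in group) word_in_subgroup:
  assumes "subgroup K G" "u \<in> K" "v \<in> K"
  shows "word (\<otimes>) \<one> u v ns \<in> K"
  using assms(2,3)
proof (induction ns arbitrary: u v)
  case Nil
  then show ?case using assms(1) by (simp add: subgroup.one_closed)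
next
  case (Cons n ns)
  have "pow_word (\<otimes>) \<one> u n \<in> K"
    using assms(1) Cons.prems(1)
    by (induction n) (auto intro: subgroup.one_closed subgroup.m_closed)
  with Cons assms(1) show ?case by (auto intro: subgroup.m_closed)
qed

lemma (in group) alt_word_in_generate:
  "alt_word (\<otimes>) \<one> x y n \<in> generate G {x, y}"
  by (induction n) (auto intro: generate.intros)

lemma (in group) alt_word_double:
  assumes "x \<in> carrier G" "y \<in> carrier G"
  shows "alt_word (\<otimes>) \<one> x y (2 * n) = (x \<otimes> y) [^] n"
proof (induction n)
  case (Suc n)
  have "alt_word (\<otimes>) \<one> x y (2 * Suc n) = x \<otimes> (y \<otimes> alt_word (\<otimes>) \<one> x y (2 * n))"
    by simp
  with Suc assms show ?case
    by (subst nat_pow_Suc2) (simp_all add: m_assoc)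
qed simp

text \<open>Left multiplication by the leading letter cancels it, by the other letter lengthens the
  word, and the period closes up because the word of length \<open>2 * k\<close> is trivial.\<close>

lemma (in group) generate_two_involutions:
  assumes "x \<in> carrier G" "y \<in> carrier G" "x \<otimes> x = \<one>" "y \<otimes> y = \<one>"
    and "0 < k" "alt_word (\<otimes>) \<one> x y (2 * k) = \<one>"
  shows "generate G {x, y} = alt_word (\<otimes>) \<one> x y ` {..<2 * k}"
proof
  let ?w = "alt_word (\<otimes>) \<one> x y"
  have w: "?w n \<in> carrier G" for n
    using alt_word_in_generate generate_in_carrier[of "{x, y}"] assms(1,2) by blast
  have cancel: "z \<otimes> (z \<otimes> g) = g" if "z \<in> {x, y}" "g \<in> carrier G" for z g
    using that assms(1-4) by (auto simp flip: m_assoc)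
  have step: "s \<otimes> ?w i \<in> ?w ` {..<2 * k}" if "s \<in> {x, y}" "i < 2 * k" for s i
  proof (cases "s = (if even i then y else x)")
    case True
    then have "s \<otimes> ?w i = ?w (Suc i)" by simp
    moreover have "Suc i < 2 * k \<or> ?w (Suc i) = ?w 0"
      using that(2) assms(6) by (cases "Suc i = 2 * k") auto
    ultimately show ?thesis
      using assms(5) by (metis imageI lessThan_iff mult_pos_pos zero_less_numeral)
  next
    case False
    show ?thesis
    proof (cases i)
      case 0
      then have "s = x" using False that by auto
      \<comment> \<open>The trivial word of length \<open>2 * k\<close> begins with
        \<open>x\<close>, so the rest of it, which is the last word of the period, equals
        \<open>x\<close>.\<close>
      obtain j where j: "2 * k = Suc j" "odd j"
        using assms(5) by (cases "2 * k") (auto, metis even_Suc even_mult_iff even_numeral)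
      then have "x \<otimes> ?w j = \<one>" using assms(6) by simp
      then have "s \<otimes> ?w i = ?w j"
        using cancel[of x "?w j"] w 0 \<open>s = x\<close> by simp
      then show ?thesis using j by auto
    next
      case (Suc j)
      then have "?w i = s \<otimes> ?w j" using False that(1) by (auto split: if_splits)
      then have "s \<otimes> ?w i = ?w j" using cancel[OF that(1) w] by simp
      then show ?thesis using Suc that(2) by auto
    qed
  qed
  show "generate G {x, y} \<subseteq> ?w ` {..<2 * k}"
  proof (rule generate_subset_if_left_closed)
    show "\<one> \<in> ?w ` {..<2 * k}"
      using assms(5) by (intro image_eqI[of _ _ 0]) auto
  qed (use assms w step in auto)
  show "?w ` {..<2 * k} \<subseteq> generate G {x, y}"
    using alt_word_in_generate by auto
qed

text \<open>Powers of \<open>x \<otimes> y\<close> are the words of even length, so a smaller order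
  would repeat the empty word within one period.\<close>

lemma (in group) ord_eq_if_inj_alt_word:
  assumes "x \<in> carrier G" "y \<in> carrier G"
    and "0 < k" "alt_word (\<otimes>) \<one> x y (2 * k) = \<one>"
    and "inj_on (alt_word (\<otimes>) \<one> x y) {..<2 * k}"
  shows "ord (x \<otimes> y) = k"
proof -
  have xy: "x \<otimes> y \<in> carrier G" using assms by simp
  have dvd: "ord (x \<otimes> y) dvd k"
    using assms(4) alt_word_double[OF assms(1,2)] pow_eq_id[OF xy] by simp
  then have pos: "0 < ord (x \<otimes> y)" using assms(3) by (auto intro: gr0I)
  have "\<not> ord (x \<otimes> y) < k"
  proof
    assume "ord (x \<otimes> y) < k"
    moreover have "alt_word (\<otimes>) \<one> x y (2 * ord (x \<otimes> y)) = alt_word (\<otimes>) \<one> x y 0"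
      using alt_word_double[OF assms(1,2)] xy by simp
    ultimately show False
      using inj_onD[OF assms(5)] pos by fastforce
  qed
  with dvd assms(3) show ?thesis by (auto dest: dvd_imp_le)
qed

section \<open>Invariance under group isomorphisms\<close>

lemma generate_iso:
  assumes "group G" "group H" "h \<in> iso G H" "S \<subseteq> carrier G"
  shows "generate H (h ` S) = h ` generate G S"
  using assms
  by (intro group_hom.generate_img)
    (simp_all add: group_hom_def group_hom_axioms_def iso_imp_homomorphism)

lemma ord_iso:
  assumes "group G" "group H" "h \<in> iso G H" "x \<in> carrier G"
  shows "group.ord H (h x) = group.ord G x"
proof -
  interpret group_hom G H h
    using assms by (simp add: group_hom_def group_hom_axioms_def iso_imp_homomorphism)
  have inj: "inj_on h (carrier G)" using assms(3) by (simp add: Group.iso_iff)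
  have "h x [^]\<^bsub>H\<^esub> n = \<one>\<^bsub>H\<^esub> \<longleftrightarrow> x [^]\<^bsub>G\<^esub> n = \<one>\<^bsub>G\<^esub>" for n :: nat
    using assms(4) inj_on_eq_iff[OF inj, of "x [^]\<^bsub>G\<^esub> n" "\<one>\<^bsub>G\<^esub>"]
    by (simp add: hom_nat_pow)
  then show ?thesis
    using assms(4) by (subst H.ord_unique) (simp_all add: G.pow_eq_id)
qed

lemma set_mult_iso:
  assumes "h \<in> iso G H" "A \<subseteq> carrier G" "B \<subseteq> carrier G"
  shows "h ` A <#>\<^bsub>H\<^esub> h ` B = h ` (A <#>\<^bsub>G\<^esub> B)"
proof -
  have "h x \<otimes>\<^bsub>H\<^esub> h y = h (x \<otimes>\<^bsub>G\<^esub> y)" if "x \<in> A" "y \<in> B" for x y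
    using that assms by (metis hom_mult iso_imp_homomorphism subsetD)
  then show ?thesis by (auto simp: set_mult_def image_iff)
qed

text \<open>Injectivity is what lets images pass through both intersections of the linearity
  conditions.\<close>

lemma regular_linear_hypermap_iso:
  assumes H: "group H" and h: "h \<in> iso G H" and rlh: "regular_linear_hypermap G r0 r1 r2"
  shows "regular_linear_hypermap H (h r0) (h r1) (h r2)"
proof -
  have G: "group G" and r: "r0 \<in> carrier G" "r1 \<in> carrier G" "r2 \<in> carrier G"
    using rlh by (auto simp: regular_linear_hypermap_def involution_def)
  have bij: "bij_betw h (carrier G) (carrier H)" using h by (simp add: iso_def)
  then have inj: "inj_on h (carrier G)" and img: "h ` carrier G = carrier H"
    by (auto simp: bij_betw_def)
  have gen: "generate H (h ` S) = h ` generate G S" "generate G S \<subseteq> carrier G"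
    if "S \<subseteq> carrier G" for S
    using that generate_iso[OF G H h] group.generate_in_carrier[OF G] by auto
  let ?A = "generate G {r1, r2}" and ?B = "generate G {r0, r2}"
  have sub: "?A \<subseteq> carrier G" "?B \<subseteq> carrier G" using gen(2) r by auto
  have prod: "?A <#>\<^bsub>G\<^esub> ?B \<subseteq> carrier G" "?B <#>\<^bsub>G\<^esub> ?A \<subseteq> carrier G"
    using sub group.setmult_subset_G[OF G] by auto
  have "generate H {h r1, h r2} = h ` ?A" "generate H {h r0, h r2} = h ` ?B"
    "generate H {h r2} = h ` generate G {r2}"
    "generate H {h r0, h r1, h r2} = h ` generate G {r0, r1, r2}"
    using gen(1)[of "{r1, r2}"] gen(1)[of "{r0, r2}"] gen(1)[of "{r2}"] gen(1)[of "{r0, r1, r2}"] r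
    by auto
  then show ?thesis
    using rlh r H bij_betw_finite[OF bij] ord_iso[OF G H h] inj_on_eq_iff[OF inj] img
      bij_betwE[OF bij] set_mult_iso[OF h sub] set_mult_iso[OF h sub(2) sub(1)]
      inj_on_image_Int[OF inj sub] inj_on_image_Int[OF inj prod]
    by (simp add: regular_linear_hypermap_def involution_def image_Un)
qed

lemma orientable_iso:
  assumes "group G" "group H" "h \<in> iso G H" "r0 \<in> carrier G" "r1 \<in> carrier G" "r2 \<in> carrier G"
  shows "orientable H (h r0) (h r1) (h r2) = orientable G r0 r1 r2"
proof -
  interpret group G by fact
  have inj: "inj_on h (carrier G)" and img: "h ` carrier G = carrier H"
    and hom: "h \<in> hom G H"
    using assms(3) by (auto simp: iso_iff)
  let ?S = "{r0 \<otimes>\<^bsub>G\<^esub> r2, r1 \<otimes>\<^bsub>G\<^esub> r2}"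
  have S: "?S \<subseteq> carrier G" using assms by auto
  have "generate H {h r0 \<otimes>\<^bsub>H\<^esub> h r2, h r1 \<otimes>\<^bsub>H\<^esub> h r2} = h ` generate G ?S"
    using generate_iso[OF assms(1-3) S] assms(4-6) by (simp add: hom_mult[OF hom])
  then show ?thesis
    using inj_on_image_eq_iff[OF inj, of "generate G ?S" "carrier G"] generate_in_carrier[OF S] img
    by (auto simp: orientable_def)
qed

lemma M_sequence_iso:
  assumes "group G" "group H" "h \<in> iso G H" "r0 \<in> carrier G" "r1 \<in> carrier G" "r2 \<in> carrier G"
  shows "M_sequence H (h r0) (h r1) (h r2) = M_sequence G r0 r1 r2"
proof -
  interpret group G by fact
  have inj: "inj_on h (carrier G)" and hom: "h \<in> hom G H"
    using assms(3) by (auto simp: iso_iff)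
  have card: "card (generate H {h x, h y}) = card (generate G {x, y})"
    if "x \<in> carrier G" "y \<in> carrier G" for x y
    using that generate_iso[OF assms(1-3), of "{x, y}"] generate_in_carrier[of "{x, y}"]
    by (auto intro!: card_image inj_on_subset[OF inj])
  have ord: "group.ord H (h x \<otimes>\<^bsub>H\<^esub> h y) = ord (x \<otimes>\<^bsub>G\<^esub> y)"
    if "x \<in> carrier G" "y \<in> carrier G" for x y
    using ord_iso[OF assms(1-3), of "x \<otimes>\<^bsub>G\<^esub> y"] that by (simp add: hom_mult[OF hom])
  have "order H = order G"
    using assms(3) by (auto simp: order_def iso_def dest: bij_betw_same_card)
  with assms(4-6) show ?thesis
    by (simp add: M_sequence_def hypermap_genus_def euler_char_def num_vertices_def
        num_hyperedges_def num_hyperfaces_def card ord orientable_iso[OF assms])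
qed

text \<open>The group isomorphism itself serves as the bijection of flags.\<close>

lemma hypermap_isomorphic_iso:
  assumes "h \<in> iso G H" "r0 \<in> carrier G" "r1 \<in> carrier G" "r2 \<in> carrier G"
  shows "hypermap_isomorphic G (r0, r1, r2) H (h r0, h r1, h r2)"
  using assms by (auto simp: hypermap_isomorphic_def iso_def hom_mult intro!: exI[of _ h])

section \<open>A computable model of the group\<close>

datatype point = P1 | P2 | P3 | P4 | P5
text \<open>A map is stored as the tuple of its images, so that products and equality evaluate by
  matching. Tuples need not be bijective; \<open>A5_list\<close> singles out the even
  permutations.\<close>

datatype perm5 = Perm point point point point point

primrec ap :: "perm5 \<Rightarrow> point \<Rightarrow> point" where
  "ap (Perm a b c d e) i =
     (case i of P1 \<Rightarrow> a | P2 \<Rightarrow> b | P3 \<Rightarrow> c | P4 \<Rightarrow> d | P5 \<Rightarrow> e)"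

primrec comp5 :: "perm5 \<Rightarrow> perm5 \<Rightarrow> perm5" where
  "comp5 p (Perm a b c d e) = Perm (ap p a) (ap p b) (ap p c) (ap p d) (ap p e)"

definition id5 :: perm5 where
  "id5 = Perm P1 P2 P3 P4 P5"

primrec inv5 :: "perm5 \<Rightarrow> perm5" where
  "inv5 (Perm a b c d e) =
     (let f = (\<lambda>i. if a = i then P1 else if b = i then P2 else if c = i then P3
                   else if d = i then P4 else P5)
      in Perm (f P1) (f P2) (f P3) (f P4) (f P5))"

definition conj5 :: "perm5 \<Rightarrow> perm5 \<Rightarrow> perm5" where
  "conj5 s p = comp5 (comp5 s p) (inv5 s)"

definition swap5 :: "point \<Rightarrow> point \<Rightarrow> perm5" where
  "swap5 i j =
     (let f = (\<lambda>k. if k = i then j else if k = j then i else k)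
      in Perm (f P1) (f P2) (f P3) (f P4) (f P5))"

definition ct :: "point \<Rightarrow> point \<Rightarrow> point \<Rightarrow> point \<Rightarrow> perm5" where
  "ct i j k l = comp5 (swap5 i j) (swap5 k l)"

type_synonym elt = "perm5 \<times> bool"

fun mult5 :: "elt \<Rightarrow> elt \<Rightarrow> elt" where
  "mult5 (p, b) (q, c) = (comp5 p q, b \<noteq> c)"

definition one5 :: elt where
  "one5 = (id5, False)"

text \<open>The involution \<open>(1 3)(2 5)\<close> and the 5-cycle \<open>(1 3 5 2 4)\<close>.
  They generate \<open>A5\<close>, so a subgroup is shown to contain \<open>A5\<close> by finding
  these two in it.\<close>

definition gen_x :: elt where "gen_x = (ct P1 P3 P2 P5, False)"

definition gen_y :: elt where "gen_y = mult5 (ct P2 P5 P3 P4, False) (ct P1 P4 P2 P3, False)"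

text \<open>
  The double cosets of the subgroup generated by the 5-cycle \<open>gen_y\<close>: there are two of size 5 and
  two of size 25.
\<close>

definition A5_words :: "nat list list" where
  "A5_words =
     concat (map (\<lambda>i. [i] # [i, 1, 2, 1, 3, 1] #
       concat (map (\<lambda>j. [[i, 1, j], [i, 1, 2, 1, j]]) [0, 1, 2, 3, 4])) [0, 1, 2, 3, 4])"

definition A5_list :: "perm5 list" where
  "A5_list = map (fst \<circ> word mult5 one5 gen_y gen_x) A5_words"

definition S5_list :: "perm5 list" where
  "S5_list = A5_list @ map (comp5 (swap5 P1 P2)) A5_list"

text \<open>The identity belongs here because the central involution of the product has trivial
  component in \<open>A5\<close>.\<close>

definition square_roots :: "perm5 list" where
  "square_roots =
     [id5, ct P1 P2 P3 P4, ct P1 P3 P2 P4, ct P1 P4 P2 P3, ct P1 P2 P3 P5, ct P1 P3 P2 P5,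
      ct P1 P5 P2 P3, ct P1 P2 P4 P5, ct P1 P4 P2 P5, ct P1 P5 P2 P4, ct P1 P3 P4 P5,
      ct P1 P4 P3 P5, ct P1 P5 P3 P4, ct P2 P3 P4 P5, ct P2 P4 P3 P5, ct P2 P5 P3 P4]"

lemma distinct_A5_list: "distinct A5_list"
  by code_simp

lemma square_roots: "list_all (\<lambda>p. comp5 p p = id5 \<longrightarrow> p \<in> set square_roots) A5_list"
  by code_simp

lemma inv5_A5_list: "list_all (\<lambda>p. inv5 p \<in> set A5_list \<and> comp5 (inv5 p) p = id5) A5_list"
  by code_simp

lemma inv5_S5_list: "list_all (\<lambda>s. comp5 s (inv5 s) = id5 \<and> comp5 (inv5 s) s = id5) S5_list"
  by code_simp

section \<open>Certificates\<close>

definition preserves :: "(point \<times> point) list \<Rightarrow> perm5 \<Rightarrow> bool" where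
  "preserves E p \<longleftrightarrow> list_all (\<lambda>e. e \<in> set E) (map (\<lambda>(i, j). (ap p i, ap p j)) E)"

text \<open>The adjacency relation of a 5-cycle graph. Of a pentagon and its pentagram, which share
  their stabiliser, exactly one has the edge joining \<open>P1\<close> and \<open>P2\<close>; this
  selects the six representatives below.\<close>

definition pentagon :: "point \<Rightarrow> point \<Rightarrow> point \<Rightarrow> point \<Rightarrow> point \<Rightarrow> (point \<times> point) list" where
  "pentagon a b c d e =
     [(a, b), (b, a), (b, c), (c, b), (c, d), (d, c), (d, e), (e, d), (e, a), (a, e)]"

text \<open>
  The maximal subgroups of \<open>A5\<close> are the stabilisers of a point, of a pair of points and of a
  pentagon (together with its pentagram); each is the stabiliser of one of these relations.
\<close>

definition obstructions :: "(point \<times> point) list list" where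
  "obstructions =
     map (\<lambda>i. [(i, i)]) [P1, P2, P3, P4, P5] @
     map (\<lambda>(i, j). [(i, j), (j, i)])
       [(P1, P2), (P1, P3), (P1, P4), (P1, P5), (P2, P3),
        (P2, P4), (P2, P5), (P3, P4), (P3, P5), (P4, P5)] @
     [pentagon P1 P2 P3 P4 P5, pentagon P1 P2 P5 P3 P4, pentagon P1 P2 P3 P5 P4,
      pentagon P1 P2 P5 P4 P3, pentagon P1 P2 P4 P5 P3, pentagon P1 P2 P4 P3 P5]"

text \<open>Hence a relation from the list that is preserved by all generators certifies that they
  do not generate the group.\<close>

lemma obstructions: "list_all (\<lambda>E. \<not> (preserves E (fst gen_x) \<and> preserves E (fst gen_y))) obstructions"
  by code_simp

text \<open>
  Element orders in \<open>A5 \<times> C2\<close> are at most 10.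
\<close>

definition alt_list :: "elt \<Rightarrow> elt \<Rightarrow> elt list" where
  "alt_list x y =
     (let ws = alt_words mult5 one5 x y 21 in
      case List.find (\<lambda>k. ws ! (2 * k) = one5) [1..<11] of
        None \<Rightarrow> []
      | Some k \<Rightarrow> take (2 * k) ws)"

text \<open>
  Exponents \<open>(i, j, i', j')\<close> of relations \<open>h i * k j = k i' * h j'\<close> between alternating words
  \<open>h\<close> in \<open>r1\<close>, \<open>r2\<close> and \<open>k\<close> in \<open>r0\<close>, \<open>r2\<close>, found by a computer search, such that every generating
  triple that is not linear satisfies one of them with \<open>h i * k j\<close> in neither dihedral subgroup, unless the
  two dihedral subgroups meet in more than \<open>{1, r2}\<close>.
\<close>

definition witnesses :: "(nat \<times> nat \<times> nat \<times> nat) list" where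
  "witnesses =
     [(10, 10, 10, 10), (6, 6, 6, 6), (2, 3, 2, 3), (4, 3, 2, 5), (4, 5, 4, 5),
      (8, 15, 14, 9), (6, 2, 2, 6), (2, 6, 6, 2)]"

text \<open>
  Matching on \<open>Perm\<close> here and in \<open>conj_triple\<close> and \<open>unobstructed\<close> keeps the simplifier from
  unfolding these functions on the bound variables of enclosing abstractions, which would be slow.
\<close>

fun nonlinear :: "elt \<Rightarrow> elt \<Rightarrow> elt \<Rightarrow> bool" where
  "nonlinear (Perm a b c d e, s) (Perm a' b' c' d' e', s') r2 =
     (let r0 = (Perm a b c d e, s); r1 = (Perm a' b' c' d' e', s');
          H = alt_list r1 r2; K = alt_list r0 r2;
          h = (\<lambda>i. H ! (i mod length H)); k = (\<lambda>i. K ! (i mod length K)) in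
      H \<noteq> [] \<and> K \<noteq> [] \<and>
      (list_ex (\<lambda>g. g \<in> set K \<and> g \<notin> {one5, r2}) H \<or>
       list_ex (\<lambda>(g, g'). g = g' \<and> g \<notin> set H \<and> g \<notin> set K)
         (map (\<lambda>(i, j, i', j'). (mult5 (h i) (k j), mult5 (k i') (h j')))
           witnesses)))"

text \<open>Meant for the element lists of two subgroups containing \<open>r\<close>. The reverse
  inclusions are then automatic, and only those that can fail are tested.\<close>

definition linear_check :: "elt list \<Rightarrow> elt list \<Rightarrow> elt \<Rightarrow> bool" where
  "linear_check H K r =
     (let HK = concat (map (\<lambda>h. map (mult5 h) K) H);
          KH = concat (map (\<lambda>k. map (mult5 k) H) K) in
      list_all (\<lambda>g. g \<in> set K \<longrightarrow> g \<in> {one5, r}) H \<and>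
      list_all (\<lambda>g. g \<notin> set KH) (filter (\<lambda>g. g \<notin> set H \<and> g \<notin> set K) HK))"

text \<open>
  A row consists of a triple \<open>(r0, r1, r2)\<close>, its type, and words in \<open>r0 r2\<close> and \<open>r1 r2\<close> that evaluate
  to \<open>gen_x\<close>, to \<open>gen_y\<close> and, in the non-orientable case, to the generator of the second factor.
\<close>

type_synonym row = "(elt \<times> elt \<times> elt) \<times> (nat \<times> nat \<times> nat) \<times> (nat list \<times> nat list \<times> nat list)"

definition orientable_data :: "row list" where
  "orientable_data =
   [(((ct P1 P2 P3 P5, True), (ct P1 P2 P3 P4, True), (ct P1 P3 P2 P4, True)), (2, 5, 3),
      ([1, 1, 2, 1], [2, 1, 3, 1, 1], [])),
   (((ct P1 P2 P3 P5, True), (ct P1 P3 P2 P4, True), (ct P1 P2 P3 P4, True)), (2, 3, 5),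
      ([2, 1, 1], [1, 1, 2, 1, 1, 1, 2, 1], [])),
   (((ct P1 P4 P2 P5, True), (ct P1 P2 P3 P4, True), (ct P1 P3 P2 P4, True)), (2, 5, 5),
      ([3, 1, 1, 1], [1, 1, 4, 1, 3], [])),
   (((ct P1 P4 P3 P5, True), (ct P1 P2 P4 P5, True), (ct P1 P3 P4 P5, True)), (3, 2, 5),
      ([0, 1, 1, 2, 1, 1, 1, 2], [0, 2, 1, 2], [])),
   (((ct P1 P3 P2 P4, True), (ct P1 P2 P4 P5, True), (ct P1 P3 P4 P5, True)), (3, 3, 5),
      ([0, 1, 2, 2, 1, 1], [2, 1, 2], [])),
   (((ct P1 P4 P3 P5, True), (ct P1 P4 P2 P3, True), (ct P1 P3 P4 P5, True)), (5, 2, 3),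
      ([1, 2, 1, 1], [0, 2], [])),
   (((ct P1 P5 P3 P4, True), (ct P1 P4 P2 P3, True), (ct P1 P3 P4 P5, True)), (5, 2, 5),
      ([0, 2, 1, 3], [0, 2], []))]"
definition nonorientable_data :: "row list" where
  "nonorientable_data =
   [(((ct P1 P2 P3 P5, False), (ct P1 P2 P3 P4, True), (ct P1 P4 P2 P3, False)), (2, 5, 6),
      ([2, 1, 4, 1, 1], [4], [1, 1, 1, 1, 1, 1])),
   (((ct P1 P2 P3 P5, False), (ct P1 P3 P2 P4, True), (ct P1 P4 P2 P3, False)), (2, 5, 10),
      ([2, 1, 1, 1, 1], [4], [2, 1, 2, 1, 2, 1])),
   (((ct P1 P2 P3 P5, True), (ct P1 P4 P2 P3, False), (ct P1 P2 P3 P4, True)), (2, 3, 10),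
      ([1, 1, 1, 1, 2, 1, 1, 1], [1, 1, 1, 1, 1, 1, 1, 1], [1, 1, 1, 1, 1, 1, 1, 1, 1, 1])),
   (((ct P1 P2 P3 P5, True), (ct P1 P4 P2 P3, False), (ct P1 P3 P2 P4, True)), (2, 5, 10),
      ([1, 1, 3, 1], [2, 1, 2, 1, 1], [2, 1, 2, 1, 2, 1])),
   (((ct P1 P4 P2 P5, False), (ct P1 P2 P3 P4, True), (ct P1 P4 P2 P3, False)), (2, 3, 10),
      ([1, 1, 2, 1, 1, 1, 1, 1], [2, 1, 1, 1, 2], [1, 1, 1, 1, 1, 1, 1, 1, 1, 1])),
   (((ct P1 P4 P2 P5, True), (ct P1 P4 P2 P3, False), (ct P1 P2 P3 P4, True)), (2, 5, 6),
      ([1, 1, 4, 1, 2], [0, 1, 3, 1, 3], [1, 1, 1, 1, 1, 1])),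
   (((ct P1 P4 P3 P5, True), (ct P1 P2 P4 P5, False), (ct P1 P3 P4 P5, False)), (3, 2, 10),
      ([0, 1, 1, 1, 1, 2, 1, 2, 1, 1], [1, 1, 1, 1, 1, 1, 1], [1, 1, 1, 1, 1, 1, 1, 1, 1, 1])),
   (((ct P1 P4 P3 P5, False), (ct P1 P2 P4 P5, True), (ct P1 P3 P4 P5, True)), (3, 2, 10),
      ([0, 1, 1, 1, 1, 2, 1, 2, 1, 1], [1, 1, 1, 1, 1, 1, 1], [1, 1, 1, 1, 1, 1, 1, 1, 1, 1])),
   (((ct P1 P4 P3 P5, True), (ct P1 P4 P2 P3, False), (ct P1 P3 P4 P5, False)), (5, 2, 6),
      ([1, 2, 1, 1], [0, 2], [1, 1, 1, 1, 1, 1])),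
   (((ct P1 P5 P3 P4, True), (ct P1 P4 P2 P3, False), (ct P1 P3 P4 P5, False)), (5, 2, 10),
      ([1, 3, 1, 1], [0, 2], [1, 2, 1, 2, 1, 2])),
   (((ct P1 P4 P3 P5, False), (ct P1 P4 P2 P3, True), (ct P1 P3 P4 P5, True)), (5, 2, 6),
      ([1, 2, 1, 1], [0, 2], [1, 1, 1, 1, 1, 1])),
   (((ct P1 P5 P3 P4, False), (ct P1 P4 P2 P3, True), (ct P1 P3 P4 P5, True)), (5, 2, 10),
      ([1, 3, 1, 1], [0, 2], [1, 2, 1, 2, 1, 2]))]"
text \<open>Distinctness turns the lengths of the lists into orders of dihedral subgroups, which
  certifies the type.\<close>

definition row_check :: "row \<Rightarrow> bool" where
  "row_check = (\<lambda>((r0, r1, r2), (k, m, n), (v, w, _)).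
     (let H = alt_list r1 r2; K = alt_list r0 r2; L = alt_list r0 r1;
          word = word mult5 one5 (mult5 r0 r2) (mult5 r1 r2) in
      list_all (\<lambda>r. r \<noteq> one5 \<and> mult5 r r = one5 \<and> fst r \<in> set A5_list) [r0, r1, r2] \<and>
      distinct [r0, r1, r2] \<and>
      0 < k \<and> 0 < m \<and> 0 < n \<and> length H = 2 * k \<and> length K = 2 * m \<and> length L = 2 * n \<and>
      distinct H \<and> distinct K \<and> distinct L \<and>
      word v = gen_x \<and> word w = gen_y \<and> linear_check H K r2))"

lemma row_check: "list_all row_check (orientable_data @ nonorientable_data)"
  by code_simp

text \<open>With all three signs nontrivial, \<open>r0 r2\<close> and \<open>r1 r2\<close> lie in
  \<open>A5\<close>, which makes the hypermap orientable.\<close>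

lemma orientable_check:
  "list_all (\<lambda>((r0, r1, r2), _). snd r0 \<and> snd r1 \<and> snd r2) orientable_data"
  by code_simp

text \<open>The central involution complements \<open>A5\<close>, obtained from
  \<open>row_check\<close>, so that \<open>r0 r2\<close> and \<open>r1 r2\<close> generate
  everything.\<close>

lemma nonorientable_check:
  "list_all (\<lambda>((r0, r1, r2), _, (_, _, c)).
     word mult5 one5 (mult5 r0 r2) (mult5 r1 r2) c = (id5, True)) nonorientable_data"
  by code_simp

text \<open>All double transpositions are conjugate in \<open>S5\<close>, which allows the component
  of \<open>r2\<close> to be normalised.\<close>

lemma involution_conj:
  "list_all (\<lambda>p. list_ex (\<lambda>s. conj5 s p \<in> {id5, ct P1 P2 P3 P4}) S5_list) square_roots"
  by code_simp

fun conj_triple :: "perm5 \<Rightarrow> elt \<times> elt \<times> elt \<Rightarrow> elt \<times> elt \<times> elt" where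
  "conj_triple (Perm a b c d e) ((p0, b0), (p1, b1), (p2, b2)) =
     (let f = conj5 (Perm a b c d e) in ((f p0, b0), (f p1, b1), (f p2, b2)))"

text \<open>Only \<open>(12)(34)\<close> is kept as third component: if that of \<open>r2\<close> is
  trivial, the other two generate at most a dihedral group, so the case contributes nothing.\<close>

definition conj_triples :: "(elt \<times> elt \<times> elt) list" where
  "conj_triples =
     concat (map (\<lambda>s. filter (\<lambda>(_, _, (p, _)). p = ct P1 P2 P3 P4)
       (map (conj_triple s) (map fst (orientable_data @ nonorientable_data)))) S5_list)"

fun unobstructed :: "perm5 \<Rightarrow> perm5 \<Rightarrow> perm5 \<Rightarrow> bool" where
  "unobstructed p2 (Perm a b c d e) (Perm a' b' c' d' e') \<longleftrightarrow>
     list_all (\<lambda>E. \<not> (preserves E (Perm a b c d e) \<and> preserves E (Perm a' b' c' d' e') \<and> preserves E p2)) obstructions"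

definition unobstructed_triples :: "(perm5 \<times> perm5 \<times> perm5) list" where
  "unobstructed_triples =
     concat (map (\<lambda>p2. concat (map (\<lambda>p0. map (\<lambda>p1. (p0, p1, p2)) (filter (unobstructed p2 p0) square_roots))
       square_roots)) [id5, ct P1 P2 P3 P4])"

fun nonlinear_triple :: "elt \<times> elt \<times> elt \<Rightarrow> bool" where
  "nonlinear_triple (r0, r1, r2) = nonlinear r0 r1 r2"

text \<open>The pattern with all signs trivial is absent, since such a triple generates at most
  \<open>A5\<close>. Survivors are mere candidates, because \<open>nonlinear\<close> searches only
  among fixed witnesses.\<close>

fun linear_signs :: "perm5 \<times> perm5 \<times> perm5 \<Rightarrow> (elt \<times> elt \<times> elt) list" where
  "linear_signs (p0, p1, p2) =
     filter (\<lambda>t. \<not> nonlinear_triple t)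
       (map (\<lambda>(b0, b1, b2). ((p0, b0), (p1, b1), (p2, b2)))
         [(True, True, True), (True, True, False), (True, False, True), (True, False, False),
          (False, True, True), (False, True, False), (False, False, True)])"

text \<open>The finite heart of the proof: every candidate that survives the rejection tests is a
  conjugate of a listed triple.\<close>

lemma classification:
  "list_all (\<lambda>t. t \<in> set conj_triples) (concat (map linear_signs unobstructed_triples))"
  by code_simp

section \<open>The group structure of the model\<close>

definition A5C2 :: "elt monoid" where
  "A5C2 = \<lparr>carrier = set A5_list \<times> UNIV, monoid.mult = mult5, one = one5\<rparr>"

lemma A5C2_simps [simp]:
  "carrier A5C2 = set A5_list \<times> UNIV" "monoid.mult A5C2 = mult5" "\<one>\<^bsub>A5C2\<^esub> = one5"
  by (simp_all add: A5C2_def)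

section \<open>Identification of the model with the alternating group on the numbers 1 to 5\<close>

primrec label :: "point \<Rightarrow> nat" where
  "label P1 = 1" | "label P2 = 2" | "label P3 = 3" | "label P4 = 4" | "label P5 = 5"

text \<open>The value \<open>P5\<close> outside 1 to 5 is a default that \<open>perm_fun\<close>
  never consults.\<close>

definition point_of :: "nat \<Rightarrow> point" where
  "point_of n = (if n = 1 then P1 else if n = 2 then P2 else if n = 3 then P3
                 else if n = 4 then P4 else P5)"

definition perm_fun :: "perm5 \<Rightarrow> nat \<Rightarrow> nat" where
  "perm_fun p n = (if n \<in> {1..5} then label (ap p (point_of n)) else n)"

lemma point_of_label [simp]: "point_of (label i) = i"
  by (cases i) (simp_all add: point_of_def)

lemma label_bounds [simp]: "label i \<in> {1..5}" "Suc 0 \<le> label i" "label i \<le> 5"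
  by (cases i; simp)+

lemma label_point_of: "n \<in> {1..5} \<Longrightarrow> label (point_of n) = n"
  by (auto simp: point_of_def)

lemma perm_fun_label [simp]: "perm_fun p (label i) = label (ap p i)"
  by (simp add: perm_fun_def)

lemma ap_comp5 [simp]: "ap (comp5 p q) i = ap p (ap q i)"
  by (cases q; cases i) simp_all

lemma perm5_eqI: "(\<And>i. ap p i = ap q i) \<Longrightarrow> p = q"
  by (cases p; cases q) (metis ap.simps point.case)

lemma ap_id5 [simp]: "ap id5 i = i"
  by (cases i) (simp_all add: id5_def)

lemma comp5_assoc: "comp5 (comp5 p q) r = comp5 p (comp5 q r)"
  by (rule perm5_eqI) simp

lemma comp5_id5 [simp]: "comp5 id5 p = p" "comp5 p id5 = p"
  by (auto intro: perm5_eqI)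

lemma perm_fun_comp5: "perm_fun (comp5 p q) = perm_fun p \<circ> perm_fun q"
  by (rule ext) (auto simp: perm_fun_def)

lemma perm_fun_id5: "perm_fun id5 = id"
  by (rule ext) (auto simp: perm_fun_def label_point_of)

lemma inj_perm_fun: "inj perm_fun"
proof (rule injI)
  fix p q assume "perm_fun p = perm_fun q"
  then have "label (ap p i) = label (ap q i)" for i by (metis perm_fun_label)
  then show "p = q" by (metis perm5_eqI point_of_label)
qed

lemma perm_fun_swap5: "perm_fun (swap5 i j) = transpose (label i) (label j)"
proof
  fix n
  have "inj label" by (metis injI point_of_label)
  moreover have "ap (swap5 i j) k = (if k = i then j else if k = j then i else k)" for k
    by (cases k) (simp_all add: swap5_def Let_def)
  ultimately have "perm_fun (swap5 i j) (label k) = transpose (label i) (label j) (label k)" for k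
    by (simp add: transpose_def inj_eq)
  moreover have "perm_fun (swap5 i j) n = transpose (label i) (label j) n" if "n \<notin> {1..5}"
    using that label_bounds by (auto simp: perm_fun_def transpose_def)
  ultimately show "perm_fun (swap5 i j) n = transpose (label i) (label j) n"
    using label_point_of by metis
qed

lemma perm_fun_ct: "perm_fun (ct i j k l) = dt (label i) (label j) (label k) (label l)"
  by (simp add: ct_def dt_def perm_fun_comp5 perm_fun_swap5)

lemma dt_in_alt_group:
  assumes "{i, j, k, l} \<subseteq> {1..n}" "i \<noteq> j" "k \<noteq> l"
  shows "dt i j k l \<in> carrier (alt_group n)"
  using assms
  by (auto simp: alt_group_carrier dt_def evenperm_comp evenperm_swap permutation_swap_id
      intro!: permutes_compose permutes_swap_id)

text \<open>Membership propagates along words, so for the whole list it follows from that of the two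
  generators.\<close>

lemma perm_fun_word_in_alt_group:
  assumes "perm_fun (fst u) \<in> carrier (alt_group 5)" "perm_fun (fst v) \<in> carrier (alt_group 5)"
  shows "perm_fun (fst (word mult5 one5 u v ns)) \<in> carrier (alt_group 5)"
proof -
  interpret group "alt_group 5" by (rule alt_group_is_group)
  have one: "perm_fun (fst one5) \<in> carrier (alt_group 5)"
    using one_closed by (simp only: one5_def fst_conv perm_fun_id5 alt_group_one)
  have mult: "perm_fun (fst (mult5 g h)) \<in> carrier (alt_group 5)"
    if "perm_fun (fst g) \<in> carrier (alt_group 5)" "perm_fun (fst h) \<in> carrier (alt_group 5)" for g h
    using m_closed[OF that] by (cases g; cases h) (simp add: perm_fun_comp5 alt_group_mult)
  have pow: "perm_fun (fst (pow_word mult5 one5 u n)) \<in> carrier (alt_group 5)"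
    if "perm_fun (fst u) \<in> carrier (alt_group 5)" for u n
    using that by (induction n) (simp_all add: one mult)
  show ?thesis
    using assms by (induction ns arbitrary: u v) (simp_all add: one mult pow)
qed

lemma perm_fun_gens:
  "perm_fun (fst gen_x) \<in> carrier (alt_group 5)" "perm_fun (fst gen_y) \<in> carrier (alt_group 5)"
proof -
  interpret group "alt_group 5" by (rule alt_group_is_group)
  show "perm_fun (fst gen_x) \<in> carrier (alt_group 5)"
    by (simp add: gen_x_def perm_fun_ct dt_in_alt_group)
  show "perm_fun (fst gen_y) \<in> carrier (alt_group 5)"
    using m_closed[OF dt_in_alt_group dt_in_alt_group, of 2 5 3 4 1 4 2 3]
    by (simp add: gen_y_def perm_fun_comp5 perm_fun_ct alt_group_mult)
qed

text \<open>A counting argument: the image lies in the alternating group and has 60 elements, as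
  many as the group.\<close>

lemma perm_fun_A5_list: "perm_fun ` set A5_list = carrier (alt_group 5)"
proof (rule card_subset_eq)
  have card: "card (carrier (alt_group 5)) = 60"
    using alt_group_card_carrier[of 5] by (simp add: fact_numeral)
  then show "finite (carrier (alt_group 5))" by (simp add: card_ge_0_finite)
  show "perm_fun ` set A5_list \<subseteq> carrier (alt_group 5)"
    using perm_fun_word_in_alt_group[OF perm_fun_gens(2,1)]
    unfolding A5_list_def set_map o_def by blast
  have "length A5_list = 60" by (simp add: A5_list_def A5_words_def)
  then show "card (perm_fun ` set A5_list) = card (carrier (alt_group 5))"
    using card inj_on_subset[OF inj_perm_fun] distinct_card[OF distinct_A5_list]
    by (subst card_image) auto
qed

text \<open>This lets closure under products be inherited from the alternating group in place of a
  multiplication table.\<close>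

lemma A5_list_iff: "p \<in> set A5_list \<longleftrightarrow> perm_fun p \<in> carrier (alt_group 5)"
  using perm_fun_A5_list inj_image_mem_iff[OF inj_perm_fun] by metis

lemma id5_in_A5_list: "id5 \<in> set A5_list"
  by (simp add: A5_list_iff perm_fun_id5 alt_group_carrier permutes_id)

lemma comp5_in_A5_list: "p \<in> set A5_list \<Longrightarrow> q \<in> set A5_list \<Longrightarrow> comp5 p q \<in> set A5_list"
  using monoid.m_closed[OF group.is_monoid[OF alt_group_is_group, of 5]]
  by (simp add: A5_list_iff perm_fun_comp5 alt_group_mult)

interpretation Q: group A5C2
proof (rule groupI)
  fix g h k :: elt
  assume "g \<in> carrier A5C2" "h \<in> carrier A5C2"
  then show "g \<otimes>\<^bsub>A5C2\<^esub> h \<in> carrier A5C2"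
    by (auto intro: comp5_in_A5_list)
  show "g \<otimes>\<^bsub>A5C2\<^esub> h \<otimes>\<^bsub>A5C2\<^esub> k = g \<otimes>\<^bsub>A5C2\<^esub> (h \<otimes>\<^bsub>A5C2\<^esub> k)"
    by (cases g; cases h; cases k) (auto simp: comp5_assoc)
next
  fix g assume g: "g \<in> carrier A5C2"
  show "\<one>\<^bsub>A5C2\<^esub> \<otimes>\<^bsub>A5C2\<^esub> g = g"
    by (cases g) (simp add: one5_def)
  obtain p b where "g = (p, b)" by fastforce
  then show "\<exists>h\<in>carrier A5C2. h \<otimes>\<^bsub>A5C2\<^esub> g = \<one>\<^bsub>A5C2\<^esub>"
    using g inv5_A5_list by (intro bexI[of _ "(inv5 p, b)"]) (auto simp: one5_def list_all_iff)
qed (simp add: one5_def id5_in_A5_list)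

section \<open>Generation and non-generation in the model\<close>

lemma A5_generated:
  assumes "subgroup K A5C2" "gen_x \<in> K" "gen_y \<in> K" "p \<in> set A5_list"
  shows "(p, False) \<in> K"
proof -
  have mult: "\<not> snd g \<Longrightarrow> \<not> snd h \<Longrightarrow> \<not> snd (mult5 g h)" for g h
    by (cases g; cases h) simp
  have one: "\<not> snd one5" by (simp add: one5_def)
  have pow: "\<not> snd u \<Longrightarrow> \<not> snd (pow_word mult5 one5 u n)" for u n
    by (induction n) (simp_all add: one mult)
  have snd_word: "\<not> snd u \<Longrightarrow> \<not> snd v \<Longrightarrow> \<not> snd (word mult5 one5 u v ns)" for u v ns
    by (induction ns arbitrary: u v) (simp_all add: one mult pow)
  obtain ns where ns: "p = fst (word mult5 one5 gen_y gen_x ns)"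
    using assms(4) by (auto simp: A5_list_def)
  \<comment> \<open>Words in generators of trivial sign have trivial sign, so the word with first
    component \<open>p\<close> is \<open>(p, False)\<close> itself.\<close>
  have "\<not> snd gen_x" "\<not> snd gen_y" by (simp_all add: gen_x_def gen_y_def)
  then have "(p, False) = word mult5 one5 gen_y gen_x ns"
    using snd_word ns by (metis (full_types) prod.collapse)
  then show ?thesis using Q.word_in_subgroup[OF assms(1,3,2)] by simp
qed

lemma inv_Q: "mult5 r r = one5 \<Longrightarrow> r \<in> carrier A5C2 \<Longrightarrow> inv\<^bsub>A5C2\<^esub> r = r"
  by (rule Q.inv_equality) simp_all

lemma involution_Q_iff:
  "involution A5C2 r \<longleftrightarrow> r \<in> carrier A5C2 \<and> r \<noteq> one5 \<and> mult5 r r = one5"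
  using Q.ord_eq_2_iff by (auto simp: involution_def)

text \<open>Preservation passes to products, and the generators are their own inverses. If they
  generated everything, \<open>gen_x\<close> and \<open>gen_y\<close> would preserve
  \<open>E\<close>.\<close>

lemma not_generating_if_preserves:
  assumes "E \<in> set obstructions" "S \<subseteq> carrier A5C2"
    and "\<And>r. r \<in> S \<Longrightarrow> mult5 r r = one5 \<and> preserves E (fst r)"
  shows "generate A5C2 S \<noteq> carrier A5C2"
proof
  assume eq: "generate A5C2 S = carrier A5C2"
  have "preserves E (fst g)" if "g \<in> generate A5C2 S" for g
    using that
  proof (induction rule: generate.induct)
    case one
    then show ?case by (auto simp: one5_def preserves_def list_all_iff)
  next
    case (inv r)
    then have "inv\<^bsub>A5C2\<^esub> r = r" using assms by (intro inv_Q) auto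
    with inv assms(3) show ?case by simp
  next
    case (eng g h)
    obtain p b q c where "g = (p, b)" "h = (q, c)" by (cases g; cases h)
    with eng show ?case by (fastforce simp: preserves_def list_all_iff)
  qed (use assms(3) in auto)
  then have "preserves E (fst gen_x) \<and> preserves E (fst gen_y)"
    using perm_fun_gens by (simp add: eq mem_Times_iff A5_list_iff)
  then show False using assms(1) obstructions by (auto simp: list_all_iff)
qed

text \<open>Serves twice: to exclude triples with all signs trivial, and to show orientability of
  the first seven triples.\<close>

lemma not_generating_if_snd:
  assumes "S \<subseteq> carrier A5C2" "\<And>r. r \<in> S \<Longrightarrow> \<not> snd r"
  shows "generate A5C2 S \<noteq> carrier A5C2"
proof
  assume eq: "generate A5C2 S = carrier A5C2"
  have "subgroup (set A5_list \<times> {False}) A5C2"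
  proof (rule Q.subgroupI)
    fix g assume "g \<in> set A5_list \<times> {False}"
    then obtain p where p: "g = (p, False)" "p \<in> set A5_list" by auto
    then have "inv\<^bsub>A5C2\<^esub> g = (inv5 p, False)"
      using inv5_A5_list by (intro Q.inv_equality) (auto simp: list_all_iff one5_def)
    then show "inv\<^bsub>A5C2\<^esub> g \<in> set A5_list \<times> {False}"
      using p inv5_A5_list by (auto simp: list_all_iff)
  qed (use id5_in_A5_list comp5_in_A5_list in auto)
  moreover have "S \<subseteq> set A5_list \<times> {False}"
    using assms by (fastforce simp: mem_Times_iff)
  ultimately have "generate A5C2 S \<subseteq> set A5_list \<times> {False}"
    by (rule Q.generate_subgroup_incl[rotated])
  with eq id5_in_A5_list show False by auto
qed

section \<open>Dihedral subgroups as computed lists\<close>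

lemma alt_list_eq:
  assumes "alt_list x y \<noteq> []"
  obtains k where "0 < k" "alt_word mult5 one5 x y (2 * k) = one5"
    "alt_list x y = map (alt_word mult5 one5 x y) [0..<2 * k]"
proof -
  let ?ws = "alt_words mult5 one5 x y 21"
  have ws: "?ws = map (alt_word mult5 one5 x y) [0..<21]"
    using alt_words_eq_map[of mult5 one5 x y 0 21] by simp
  \<comment> \<open>The least \<open>k\<close> up to 10 with trivial word of length
    \<open>2 * k\<close>. Failure of the search would give the empty list, which the assumption
    excludes.\<close>
  obtain k where k: "List.find (\<lambda>k. ?ws ! (2 * k) = one5) [1..<11] = Some k"
    "alt_list x y = take (2 * k) ?ws"
    using assms by (auto simp: alt_list_def Let_def simp del: alt_words.simps split: option.splits)
  then have "k \<in> set [1..<11]" "?ws ! (2 * k) = one5"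
    by (auto simp: find_Some_iff simp del: alt_words.simps upt_rec_numeral)
  with k ws that[of k] show thesis by (auto simp: take_map simp del: upt_rec_numeral)
qed

lemma generate_alt_list:
  assumes "alt_list x y \<noteq> []" "x \<in> carrier A5C2" "y \<in> carrier A5C2"
    "mult5 x x = one5" "mult5 y y = one5"
  shows "generate A5C2 {x, y} = set (alt_list x y)"
proof -
  obtain k where "0 < k" "alt_word mult5 one5 x y (2 * k) = one5"
    "alt_list x y = map (alt_word mult5 one5 x y) [0..<2 * k]"
    using alt_list_eq[OF assms(1)] .
  then show ?thesis
    using Q.generate_two_involutions[of x y k] assms by (auto simp: atLeast0LessThan)
qed

lemma ord_alt_list:
  assumes "alt_list x y \<noteq> []" "distinct (alt_list x y)" "x \<in> carrier A5C2" "y \<in> carrier A5C2"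
  shows "2 * Q.ord (mult5 x y) = length (alt_list x y)"
proof -
  obtain k where "0 < k" "alt_word mult5 one5 x y (2 * k) = one5"
    "alt_list x y = map (alt_word mult5 one5 x y) [0..<2 * k]"
    using alt_list_eq[OF assms(1)] .
  then show ?thesis
    using Q.ord_eq_if_inj_alt_word[of x y k] assms by (auto simp: distinct_map atLeast0LessThan)
qed

text \<open>The two lists are the dihedral subgroups, so the element found contradicts one of the
  linearity conditions. Indices taken modulo the lengths always name elements of these
  subgroups.\<close>

lemma not_linear_if_nonlinear:
  assumes "nonlinear r0 r1 r2"
  shows "\<not> regular_linear_hypermap A5C2 r0 r1 r2"
proof
  assume rlh: "regular_linear_hypermap A5C2 r0 r1 r2"
  define H K where "H = alt_list r1 r2" and "K = alt_list r0 r2"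
  have inv: "r \<in> carrier A5C2 \<and> mult5 r r = one5" if "r \<in> {r0, r1, r2}" for r
    using rlh that by (auto simp: regular_linear_hypermap_def involution_Q_iff)
  obtain a b c d e s a' b' c' d' e' s' where
    "r0 = (Perm a b c d e, s)" "r1 = (Perm a' b' c' d' e', s')"
    by (metis perm5.exhaust surj_pair)
  then have nl: "H \<noteq> []" "K \<noteq> []"
    "list_ex (\<lambda>g. g \<in> set K \<and> g \<notin> {one5, r2}) H \<or>
     list_ex (\<lambda>(g, g'). g = g' \<and> g \<notin> set H \<and> g \<notin> set K)
       (map (\<lambda>(i, j, i', j').
          (mult5 (H ! (i mod length H)) (K ! (j mod length K)),
           mult5 (K ! (i' mod length K)) (H ! (j' mod length H)))) witnesses)"
    using assms by (simp_all add: H_def K_def Let_def)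
  have gens: "generate A5C2 {r1, r2} = set H" "generate A5C2 {r0, r2} = set K"
    "generate A5C2 {r2} = {one5, r2}"
    using nl(1,2) inv generate_alt_list Q.generate_involution[of r2] by (auto simp: H_def K_def)
  have cond: "set H \<inter> set K = {one5, r2}"
    "(set H <#>\<^bsub>A5C2\<^esub> set K) \<inter> (set K <#>\<^bsub>A5C2\<^esub> set H) = set H \<union> set K"
    using rlh by (auto simp: regular_linear_hypermap_def gens)
  have nth: "H ! (i mod length H) \<in> set H" "K ! (i mod length K) \<in> set K" for i
    using nl(1,2) by simp_all
  from nl(3) show False
  proof
    assume "list_ex (\<lambda>g. g \<in> set K \<and> g \<notin> {one5, r2}) H"
    then show False using cond(1) by (auto simp: list_ex_iff)
  next
    assume "list_ex (\<lambda>(g, g'). g = g' \<and> g \<notin> set H \<and> g \<notin> set K)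
       (map (\<lambda>(i, j, i', j').
          (mult5 (H ! (i mod length H)) (K ! (j mod length K)),
           mult5 (K ! (i' mod length K)) (H ! (j' mod length H)))) witnesses)"
    then obtain i j i' j' where
      eq: "mult5 (H ! (i mod length H)) (K ! (j mod length K)) =
         mult5 (K ! (i' mod length K)) (H ! (j' mod length H))"
      and notin: "mult5 (H ! (i mod length H)) (K ! (j mod length K)) \<notin> set H \<union> set K"
      by (auto simp: list_ex_iff)
    let ?g = "mult5 (H ! (i mod length H)) (K ! (j mod length K))"
      and ?g' = "mult5 (K ! (i' mod length K)) (H ! (j' mod length H))"
    have "?g \<in> set H <#>\<^bsub>A5C2\<^esub> set K" "?g' \<in> set K <#>\<^bsub>A5C2\<^esub> set H"
      using nth unfolding set_mult_def by auto
    then show False using cond(2) eq notin by auto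
  qed
qed

section \<open>Automorphisms given by conjugation in \<open>S5\<close>\<close>

lemma conj_iso:
  assumes "s \<in> set S5_list"
  shows "(\<lambda>(p, b). (conj5 s p, b)) \<in> iso A5C2 A5C2"
proof -
  have inv: "comp5 s (inv5 s) = id5" "comp5 (inv5 s) s = id5"
    using assms inv5_S5_list by (auto simp: list_all_iff)
  have cancel: "comp5 (inv5 s) (comp5 s p) = p" "comp5 s (comp5 (inv5 s) p) = p" for p
    using inv by (simp_all flip: comp5_assoc)
  have permutes: "perm_fun p permutes {1..5}" if "comp5 p q = id5" "comp5 q p = id5" for p q
  proof (rule bij_imp_permutes)
    have "perm_fun q \<circ> perm_fun p = id" "perm_fun p \<circ> perm_fun q = id"
      using that by (simp_all flip: perm_fun_comp5 add: perm_fun_id5)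
    then have "perm_fun q (perm_fun p n) = n" "perm_fun p (perm_fun q n) = n" for n
      by (simp_all add: fun_eq_iff)
    moreover have "perm_fun r n \<in> {1..5}" if "n \<in> {1..5}" for n r
      using that label_bounds by (simp add: perm_fun_def)
    ultimately show "bij_betw (perm_fun p) {1..5} {1..5}"
      by (intro bij_betw_byWitness[where f' = "perm_fun q"]) auto
  qed (auto simp: perm_fun_def)
  have s: "perm_fun s permutes {1..5}" "perm_fun (inv5 s) permutes {1..5}"
    using permutes inv by blast+
  then have perm: "permutation (perm_fun s)" "permutation (perm_fun (inv5 s))"
    by (auto simp: permutation_permutes)
  \<comment> \<open>A permutation and its inverse have equal parity; hence conjugation by an odd
    \<open>s\<close> also preserves evenness.\<close>
  have "evenperm (perm_fun s \<circ> perm_fun (inv5 s))"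
    using inv by (simp flip: perm_fun_comp5 add: perm_fun_id5)
  then have even: "evenperm (perm_fun s) = evenperm (perm_fun (inv5 s))"
    using evenperm_comp[OF perm] by simp
  have closed: "conj5 s p \<in> set A5_list" if "p \<in> set A5_list" for p
  proof -
    have p: "perm_fun p permutes {1..5}" "evenperm (perm_fun p)"
      using that by (auto simp: A5_list_iff alt_group_carrier)
    then have "permutation (perm_fun p)" by (auto simp: permutation_permutes)
    with p s perm even show ?thesis
      by (auto simp: conj5_def A5_list_iff alt_group_carrier perm_fun_comp5 evenperm_comp
          permutation_compose intro!: permutes_compose)
  qed
  have "p = q" if "conj5 s p = conj5 s q" for p q
  proof -
    have "comp5 (inv5 s) (comp5 (conj5 s r) s) = r" for r
      by (simp add: conj5_def comp5_assoc inv cancel)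
    then show ?thesis using that by metis
  qed
  then have inj: "inj_on (\<lambda>(p, b). (conj5 s p, b)) (carrier A5C2)"
    by (auto simp: inj_on_def)
  \<comment> \<open>An injective map of a finite set into itself is onto.\<close>
  have "(\<lambda>(p, b). (conj5 s p, b)) ` carrier A5C2 = carrier A5C2"
    using closed by (intro endo_inj_surj[OF _ _ inj]) auto
  moreover have "(\<lambda>(p, b). (conj5 s p, b)) \<in> hom A5C2 A5C2"
    using closed by (auto simp: hom_def conj5_def comp5_assoc cancel)
  ultimately show ?thesis using inj by (simp add: Group.iso_iff)
qed

section \<open>The listed triples\<close>

lemma data_row:
  assumes "((r0, r1, r2), (k, m, n), (v, w, c)) \<in> set (orientable_data @ nonorientable_data)"
  shows "involution A5C2 r0" "involution A5C2 r1" "involution A5C2 r2"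
    and "distinct [r0, r1, r2]"
    and "Q.ord (mult5 r1 r2) = k" "Q.ord (mult5 r0 r2) = m" "Q.ord (mult5 r0 r1) = n"
    and "card (generate A5C2 {r1, r2}) = 2 * k" "card (generate A5C2 {r0, r2}) = 2 * m"
      "card (generate A5C2 {r0, r1}) = 2 * n"
    and "generate A5C2 {r1, r2} = set (alt_list r1 r2)"
      "generate A5C2 {r0, r2} = set (alt_list r0 r2)"
    and "linear_check (alt_list r1 r2) (alt_list r0 r2) r2"
    and "\<And>p. p \<in> set A5_list \<Longrightarrow> (p, False) \<in> generate A5C2 {mult5 r0 r2, mult5 r1 r2}"
proof -
  have "row_check ((r0, r1, r2), (k, m, n), (v, w, c))"
    using assms row_check unfolding list_all_iff by blast
  then have invs: "\<And>r. r \<in> {r0, r1, r2} \<Longrightarrow> r \<noteq> one5 \<and> mult5 r r = one5 \<and> fst r \<in> set A5_list"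
    and dist: "distinct [r0, r1, r2]"
    and pos: "0 < k" "0 < m" "0 < n"
    and len: "length (alt_list r1 r2) = 2 * k" "length (alt_list r0 r2) = 2 * m"
      "length (alt_list r0 r1) = 2 * n"
    and dists: "distinct (alt_list r1 r2)" "distinct (alt_list r0 r2)" "distinct (alt_list r0 r1)"
    and words: "word mult5 one5 (mult5 r0 r2) (mult5 r1 r2) v = gen_x"
      "word mult5 one5 (mult5 r0 r2) (mult5 r1 r2) w = gen_y"
    and lin: "linear_check (alt_list r1 r2) (alt_list r0 r2) r2"
    unfolding row_check_def Let_def by auto
  have car: "r \<in> carrier A5C2" if "r \<in> {r0, r1, r2}" for r
    using invs[OF that] by (simp add: mem_Times_iff)
  show "involution A5C2 r0" "involution A5C2 r1" "involution A5C2 r2"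
    using invs car by (auto simp: involution_Q_iff)
  have nonempty: "alt_list r1 r2 \<noteq> []" "alt_list r0 r2 \<noteq> []" "alt_list r0 r1 \<noteq> []"
    using len pos by auto
  show "Q.ord (mult5 r1 r2) = k" "Q.ord (mult5 r0 r2) = m" "Q.ord (mult5 r0 r1) = n"
    using ord_alt_list[OF nonempty(1) dists(1)] ord_alt_list[OF nonempty(2) dists(2)]
      ord_alt_list[OF nonempty(3) dists(3)] car len by auto
  have gens: "generate A5C2 {r1, r2} = set (alt_list r1 r2)"
    "generate A5C2 {r0, r2} = set (alt_list r0 r2)"
    "generate A5C2 {r0, r1} = set (alt_list r0 r1)"
    using generate_alt_list[OF nonempty(1)] generate_alt_list[OF nonempty(2)]
      generate_alt_list[OF nonempty(3)] car invs by blast+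
  then show "generate A5C2 {r1, r2} = set (alt_list r1 r2)"
    "generate A5C2 {r0, r2} = set (alt_list r0 r2)" by blast+
  show "card (generate A5C2 {r1, r2}) = 2 * k" "card (generate A5C2 {r0, r2}) = 2 * m"
    "card (generate A5C2 {r0, r1}) = 2 * n"
    unfolding gens using len dists by (simp_all add: distinct_card)
  show "distinct [r0, r1, r2]" "linear_check (alt_list r1 r2) (alt_list r0 r2) r2"
    using dist lin by blast+
  let ?S = "{mult5 r0 r2, mult5 r1 r2}"
  have "?S \<subseteq> carrier A5C2"
    using Q.m_closed[OF car car] by auto
  then have sub: "subgroup (generate A5C2 ?S) A5C2"
    by (rule Q.generate_is_subgroup)
  have "mult5 r0 r2 \<in> generate A5C2 ?S" "mult5 r1 r2 \<in> generate A5C2 ?S"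
    by (simp_all add: generate.incl)
  \<comment> \<open>The certified words put \<open>gen_x\<close> and \<open>gen_y\<close> into this
    subgroup, hence all of \<open>A5\<close>.\<close>
  from Q.word_in_subgroup[OF sub this, simplified] words
  have "gen_x \<in> generate A5C2 ?S" "gen_y \<in> generate A5C2 ?S" by metis+
  then show "(p, False) \<in> generate A5C2 ?S" if "p \<in> set A5_list" for p
    using A5_generated[OF sub] that by blast
qed

text \<open>\<open>A5\<close> has index two, so a single element of nontrivial sign completes it to
  the whole group.\<close>

lemma carrier_eqI:
  assumes "subgroup K A5C2" "\<And>p. p \<in> set A5_list \<Longrightarrow> (p, False) \<in> K" "r \<in> K" "snd r"
  shows "K = carrier A5C2"
proof
  show "K \<subseteq> carrier A5C2" by (rule subgroup.subset[OF assms(1)])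
  obtain q where q: "r = (q, True)" using assms(4) by (metis (full_types) prod.collapse)
  show "carrier A5C2 \<subseteq> K"
  proof
    fix g assume "g \<in> carrier A5C2"
    then obtain p b where g: "g = (p, b)" "p \<in> set A5_list" by auto
    have "q \<in> set A5_list" using assms(3) subgroup.subset[OF assms(1)] q by auto
    then have "(comp5 p (inv5 q), False) \<in> K"
      using inv5_A5_list g(2) by (auto simp: list_all_iff intro!: assms(2) comp5_in_A5_list)
    then have "mult5 (comp5 p (inv5 q), False) (q, True) \<in> K"
      using subgroup.m_closed[OF assms(1) _ assms(3)] by (simp add: q del: mult5.simps)
    moreover have "comp5 (inv5 q) q = id5"
      using inv5_A5_list \<open>q \<in> set A5_list\<close> by (auto simp: list_all_iff)
    ultimately have "(p, True) \<in> K" by (simp add: comp5_assoc)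
    then show "g \<in> K" using assms(2) g by (cases b) auto
  qed
qed

lemma nonorientable_row:
  assumes "((r0, r1, r2), t, w) \<in> set nonorientable_data"
  shows "generate A5C2 {mult5 r0 r2, mult5 r1 r2} = carrier A5C2"
proof -
  obtain k m n v u c where [simp]: "t = (k, m, n)" "w = (v, u, c)" by (metis surj_pair)
  note row = data_row[of r0 r1 r2 k m n v u c]
  let ?S = "{mult5 r0 r2, mult5 r1 r2}"
  have S: "?S \<subseteq> carrier A5C2"
    using Q.m_closed row(1-3) assms by (auto simp: involution_def simp del: mult5.simps)
  have sub: "subgroup (generate A5C2 ?S) A5C2" by (rule Q.generate_is_subgroup[OF S])
  have "word mult5 one5 (mult5 r0 r2) (mult5 r1 r2) c = (id5, True)"
    using nonorientable_check assms by (fastforce simp: list_all_iff)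
  moreover have "mult5 r0 r2 \<in> generate A5C2 ?S" "mult5 r1 r2 \<in> generate A5C2 ?S"
    by (simp_all add: generate.incl)
  ultimately have "(id5, True) \<in> generate A5C2 ?S"
    using Q.word_in_subgroup[OF sub, of "mult5 r0 r2" "mult5 r1 r2" c] by simp
  then show ?thesis
    using carrier_eqI[OF sub] row(14) assms by simp
qed

lemma orientable_row:
  assumes "((r0, r1, r2), t, w) \<in> set orientable_data"
  shows "orientable A5C2 r0 r1 r2" "generate A5C2 {r0, r1, r2} = carrier A5C2"
proof -
  obtain k m n v u c where [simp]: "t = (k, m, n)" "w = (v, u, c)" by (metis surj_pair)
  note row = data_row[of r0 r1 r2 k m n v u c]
  have car: "{r0, r1, r2} \<subseteq> carrier A5C2" using row(1-3) assms by (auto simp: involution_def)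
  have snd: "snd r0" "snd r1" "snd r2"
    using orientable_check assms by (fastforce simp: list_all_iff)+
  let ?S = "{mult5 r0 r2, mult5 r1 r2}"
  have S: "?S \<subseteq> carrier A5C2"
    using Q.m_closed car by (auto simp del: mult5.simps)
  \<comment> \<open>The signs of two factors cancel.\<close>
  have "\<not> snd g" if "g \<in> ?S" for g
    using that snd by (cases r0; cases r1; cases r2) auto
  then show "orientable A5C2 r0 r1 r2"
    using not_generating_if_snd[OF S] by (simp add: orientable_def)
  have sub: "subgroup (generate A5C2 {r0, r1, r2}) A5C2" by (rule Q.generate_is_subgroup[OF car])
  have "?S \<subseteq> generate A5C2 {r0, r1, r2}"
    using subgroup.m_closed[OF sub] generate.incl[of _ "{r0, r1, r2}" A5C2] by auto
  then have "generate A5C2 ?S \<subseteq> generate A5C2 {r0, r1, r2}"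
    by (rule Q.generate_subgroup_incl[OF _ sub])
  \<comment> \<open>The products supply \<open>A5\<close>, and \<open>r2\<close> supplies the
    nontrivial sign.\<close>
  then show "generate A5C2 {r0, r1, r2} = carrier A5C2"
    using row(14) assms snd(3) generate.incl[of r2 "{r0, r1, r2}" A5C2]
    by (intro carrier_eqI[OF sub, of r2]) auto
qed

lemma linear_row:
  assumes "((r0, r1, r2), t, w) \<in> set (orientable_data @ nonorientable_data)"
  shows "regular_linear_hypermap A5C2 r0 r1 r2"
proof -
  obtain k m n v u c where tw: "t = (k, m, n)" "w = (v, u, c)" by (metis surj_pair)
  note row = data_row[OF assms[unfolded tw]]
  let ?H = "alt_list r1 r2" and ?K = "alt_list r0 r2"
  have car: "{r0, r1, r2} \<subseteq> carrier A5C2" using row(1-3) by (auto simp: involution_def)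
  have r2: "mult5 r2 r2 = one5" using row(3) by (simp add: involution_Q_iff)
  have gen: "generate A5C2 {r0, r1, r2} = carrier A5C2"
  proof (cases "((r0, r1, r2), t, w) \<in> set orientable_data")
    case False
    then have "((r0, r1, r2), t, w) \<in> set nonorientable_data" using assms by simp
    note carrier = nonorientable_row[OF this]
    have sub: "subgroup (generate A5C2 {r0, r1, r2}) A5C2" by (rule Q.generate_is_subgroup[OF car])
    have "{mult5 r0 r2, mult5 r1 r2} \<subseteq> generate A5C2 {r0, r1, r2}"
      using subgroup.m_closed[OF sub] generate.incl[of _ "{r0, r1, r2}" A5C2] by auto
    from Q.generate_subgroup_incl[OF this sub] show ?thesis
      using carrier subgroup.subset[OF sub] by auto
  qed (rule orientable_row)
  have one: "one5 \<in> set ?H" "one5 \<in> set ?K" "r2 \<in> set ?H" "r2 \<in> set ?K"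
    unfolding row(11,12)[symmetric]
    using generate.one[of A5C2] generate.incl[of r2 _ A5C2] by simp_all
  have inter: "set ?H \<inter> set ?K = {one5, r2}"
    using row(13) one by (auto simp: linear_check_def Let_def list_all_iff)
  have HK: "set ?H <#>\<^bsub>A5C2\<^esub> set ?K = (\<Union>h\<in>set ?H. mult5 h ` set ?K)"
    "set ?K <#>\<^bsub>A5C2\<^esub> set ?H = (\<Union>k\<in>set ?K. mult5 k ` set ?H)"
    by (auto simp: set_mult_def)
  have "(set ?H <#>\<^bsub>A5C2\<^esub> set ?K) \<inter> (set ?K <#>\<^bsub>A5C2\<^esub> set ?H) \<subseteq> set ?H \<union> set ?K"
  proof
    fix g
    assume g: "g \<in> (set ?H <#>\<^bsub>A5C2\<^esub> set ?K) \<inter> (set ?K <#>\<^bsub>A5C2\<^esub> set ?H)"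
    then have "g \<in> set (concat (map (\<lambda>h. map (mult5 h) ?K) ?H))"
      "g \<in> set (concat (map (\<lambda>k. map (mult5 k) ?H) ?K))"
      unfolding HK by (simp_all only: Int_iff set_concat set_map image_image)
    then show "g \<in> set ?H \<union> set ?K"
      using row(13) unfolding linear_check_def Let_def list_all_iff set_filter by blast
  qed
  \<comment> \<open>Each subgroup contains the identity, so each lies in both products.\<close>
  moreover have "set ?H \<union> set ?K \<subseteq> (set ?H <#>\<^bsub>A5C2\<^esub> set ?K) \<inter> (set ?K <#>\<^bsub>A5C2\<^esub> set ?H)"
  proof -
    have unit: "mult5 g one5 = g" "mult5 one5 g = g" for g by (cases g; simp add: one5_def)+
    have "g \<in> mult5 g ` set ?H" "g \<in> mult5 g ` set ?K" for g
      using one(1,2) unit(1)[of g] by (metis imageI)+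
    moreover have "mult5 one5 ` A = A" for A
      by (simp add: unit)
    ultimately show ?thesis
      unfolding HK using one(1,2) by (intro subsetI) (metis (no_types, lifting) IntI UN_I UnE)
  qed
  ultimately have lin: "(set ?H <#>\<^bsub>A5C2\<^esub> set ?K) \<inter> (set ?K <#>\<^bsub>A5C2\<^esub> set ?H) = set ?H \<union> set ?K"
    by (rule equalityI)
  have "generate A5C2 {r2} = {one5, r2}"
    using Q.generate_involution[of r2] car r2 by simp
  then show ?thesis
    unfolding regular_linear_hypermap_def row(11,12)
    using row(1-4) gen inter lin Q.group_axioms
    by (simp add: finite_cartesian_product)
qed

section \<open>Classification\<close>

definition listed :: "(elt \<times> elt \<times> elt) set" where
  "listed = fst ` set (orientable_data @ nonorientable_data)"

lemma listedE:
  assumes "(r0, r1, r2) \<in> listed"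
  obtains t w where "((r0, r1, r2), t, w) \<in> set (orientable_data @ nonorientable_data)"
proof -
  obtain r where r: "r \<in> set (orientable_data @ nonorientable_data)" "(r0, r1, r2) = fst r"
    using assms unfolding listed_def by (elim imageE)
  have "((r0, r1, r2), fst (snd r), snd (snd r)) \<in> set (orientable_data @ nonorientable_data)"
    using r by (simp del: set_append)
  then show thesis by (rule that)
qed

lemma conj_triple_eq:
  "conj_triple s ((p0, b0), (p1, b1), (p2, b2)) = ((conj5 s p0, b0), (conj5 s p1, b1), (conj5 s p2, b2))"
  by (cases s) (simp add: Let_def)

lemma conj_triplesE:
  assumes "t \<in> set conj_triples"
  obtains s r where "s \<in> set S5_list" "r \<in> listed" "t = conj_triple s r"
proof -
  from assms obtain s where s: "s \<in> set S5_list"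
    "t \<in> set (filter (\<lambda>(_, _, (p, _)). p = ct P1 P2 P3 P4)
       (map (conj_triple s) (map fst (orientable_data @ nonorientable_data))))"
    unfolding conj_triples_def set_concat set_map by (elim UN_E imageE) simp
  then have "t \<in> conj_triple s ` listed"
    unfolding listed_def set_filter set_map by (elim CollectE conjunct1)
  with s(1) that show thesis by blast
qed

text \<open>Peels off one layer of an enumeration without expanding the concrete lists.\<close>

lemma in_concat_mapI: "x \<in> set xs \<Longrightarrow> y \<in> set (f x) \<Longrightarrow> y \<in> set (concat (map f xs))"
  by auto

lemma unobstructed_triplesI:
  assumes "p2 \<in> {id5, ct P1 P2 P3 P4}" "p0 \<in> set square_roots" "p1 \<in> set square_roots"
    and "unobstructed p2 p0 p1"
  shows "(p0, p1, p2) \<in> set unobstructed_triples"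
  unfolding unobstructed_triples_def
proof (rule in_concat_mapI[of p2], goal_cases)
  case 2
  show ?case
    by (rule in_concat_mapI[of p0]) (use assms in simp_all)
qed (use assms in simp)

lemma linear_signsI:
  assumes "b0 \<or> b1 \<or> b2" "\<not> nonlinear (p0, b0) (p1, b1) (p2, b2)"
  shows "((p0, b0), (p1, b1), (p2, b2)) \<in> set (linear_signs (p0, p1, p2))"
  using assms by (cases b0; cases b1; cases b2) simp_all

lemma regular_linear_hypermap_classification:
  assumes "regular_linear_hypermap A5C2 r0 r1 r2"
  shows "\<exists>\<sigma>\<in>iso A5C2 A5C2. (\<sigma> r0, \<sigma> r1, \<sigma> r2) \<in> listed"
proof -
  obtain p0 b0 p1 b1 p2 b2 where r: "r0 = (p0, b0)" "r1 = (p1, b1)" "r2 = (p2, b2)"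
    by (metis surj_pair)
  have roots: "p \<in> set square_roots" if "involution A5C2 (p, b)" for p b
  proof -
    have "p \<in> set A5_list" "comp5 p p = id5"
      using that by (simp_all add: involution_Q_iff one5_def)
    then show ?thesis using square_roots unfolding list_all_iff by blast
  qed
  have "p2 \<in> set square_roots"
    using assms roots unfolding r regular_linear_hypermap_def by blast
  \<comment> \<open>Conjugation by \<open>s\<close> normalises the component of \<open>r2\<close>,
    so that the table applies.\<close>
  then obtain s where s: "s \<in> set S5_list" "conj5 s p2 \<in> {id5, ct P1 P2 P3 P4}"
    using involution_conj unfolding list_all_iff list_ex_iff by blast
  let ?\<sigma> = "\<lambda>(p, b). (conj5 s p, b)"
  let ?t = "((conj5 s p0, b0), (conj5 s p1, b1), (conj5 s p2, b2))"
  have \<sigma>: "?\<sigma> \<in> iso A5C2 A5C2" using conj_iso s(1) by blast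
  have rlh: "regular_linear_hypermap A5C2 (conj5 s p0, b0) (conj5 s p1, b1) (conj5 s p2, b2)"
    using regular_linear_hypermap_iso[OF Q.group_axioms \<sigma> assms] by (simp add: r)
  then have inv: "involution A5C2 (conj5 s p0, b0)" "involution A5C2 (conj5 s p1, b1)"
      "involution A5C2 (conj5 s p2, b2)"
    and gen: "generate A5C2 {(conj5 s p0, b0), (conj5 s p1, b1), (conj5 s p2, b2)} = carrier A5C2"
    unfolding regular_linear_hypermap_def by blast+
  then have roots': "conj5 s p0 \<in> set square_roots" "conj5 s p1 \<in> set square_roots"
    using roots by blast+
  have sub: "{(conj5 s p0, b0), (conj5 s p1, b1), (conj5 s p2, b2)} \<subseteq> carrier A5C2"
    using inv unfolding involution_Q_iff by blast
  have sq: "mult5 r r = one5" if "r \<in> {(conj5 s p0, b0), (conj5 s p1, b1), (conj5 s p2, b2)}" for r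
    using inv that unfolding involution_Q_iff by blast
  have "\<not> (preserves E (conj5 s p0) \<and> preserves E (conj5 s p1) \<and> preserves E (conj5 s p2))"
    if "E \<in> set obstructions" for E
    using not_generating_if_preserves[OF that sub] sq gen by fastforce
  then have "unobstructed (conj5 s p2) (conj5 s p0) (conj5 s p1)"
    by (cases "conj5 s p0"; cases "conj5 s p1") (auto simp: list_all_iff)
  then have "(conj5 s p0, conj5 s p1, conj5 s p2) \<in> set unobstructed_triples"
    by (rule unobstructed_triplesI[OF s(2) roots'])
  moreover have "b0 \<or> b1 \<or> b2"
    using not_generating_if_snd[OF sub] gen by fastforce
  then have "?t \<in> set (linear_signs (conj5 s p0, conj5 s p1, conj5 s p2))"
    using not_linear_if_nonlinear rlh by (intro linear_signsI) blast+
  ultimately have "?t \<in> set conj_triples"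
    using classification by (auto simp: list_all_iff)
  \<comment> \<open>The normalised triple is the conjugate by \<open>s'\<close> of a listed one; the
    isomorphism sought conjugates by \<open>s\<close> and then undoes \<open>s'\<close>.\<close>
  then obtain s' t where s': "s' \<in> set S5_list" "t \<in> listed" "?t = conj_triple s' t"
    by (rule conj_triplesE)
  obtain q0 c0 q1 c1 q2 c2 where t: "t = ((q0, c0), (q1, c1), (q2, c2))"
    by (metis surj_pair)
  let ?\<tau> = "\<lambda>(p, b). (conj5 s' p, b)"
  have \<tau>: "?\<tau> \<in> iso A5C2 A5C2" using conj_iso s'(1) by blast
  obtain u w where "((((q0, c0), (q1, c1), (q2, c2))), u, w)
      \<in> set (orientable_data @ nonorientable_data)"
    using s'(2) unfolding t by (rule listedE)
  \<comment> \<open>Membership in the carrier is needed because \<open>inv_into\<close> undoes the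
    conjugation only there.\<close>
  from linear_row[OF this] have "{q0, q1, q2} \<subseteq> set A5_list"
    by (simp add: regular_linear_hypermap_def involution_def)
  then have q: "inv_into (carrier A5C2) ?\<tau> (conj5 s' q, c) = (q, c)" if "q \<in> {q0, q1, q2}" for q c
    using that \<tau> inv_into_f_f[of ?\<tau> "carrier A5C2" "(q, c)"] by (auto simp: Group.iso_iff)
  have "conj5 s p0 = conj5 s' q0" "b0 = c0" "conj5 s p1 = conj5 s' q1" "b1 = c1"
    "conj5 s p2 = conj5 s' q2" "b2 = c2"
    using s'(3) by (simp_all add: t conj_triple_eq)
  then have "((inv_into (carrier A5C2) ?\<tau> \<circ> ?\<sigma>) r0, (inv_into (carrier A5C2) ?\<tau> \<circ> ?\<sigma>) r1,
      (inv_into (carrier A5C2) ?\<tau> \<circ> ?\<sigma>) r2) = t"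
    by (simp add: r t q del: A5C2_simps)
  moreover have "inv_into (carrier A5C2) ?\<tau> \<circ> ?\<sigma> \<in> iso A5C2 A5C2"
    using iso_set_trans[OF \<sigma> Q.iso_set_sym[OF \<tau>]] .
  ultimately show ?thesis using s'(2) by metis
qed

section \<open>Computation of the sequences and transfer to the given direct product\<close>

lemma order_A5C2: "order A5C2 = 120"
proof -
  have "card (set A5_list) = 60"
    using distinct_card[OF distinct_A5_list] by (simp add: A5_list_def A5_words_def)
  then show ?thesis by (simp add: order_def card_cartesian_product)
qed

text \<open>The dihedral subgroups have orders \<open>2 * k\<close>, \<open>2 * m\<close> and
  \<open>2 * n\<close> in a group of order 120, so type and orientability determine the whole
  sequence. The number 60 is half the group order.\<close>

definition hypermap_seq_of :: "bool \<Rightarrow> nat \<times> nat \<times> nat \<Rightarrow> hypermap_seq" where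
  "hypermap_seq_of ori = (\<lambda>(k, m, n).
     let V = 120 div (2 * k); E = 120 div (2 * m); F = 120 div (2 * n);
         \<chi> = of_nat V + of_nat E + of_nat F - 60 in
     (if ori then (2 - \<chi>) / 2 else 2 - \<chi>, (k, m, n), (V, E, F), 120))"

lemma M_sequence_row:
  assumes "((r0, r1, r2), t, w) \<in> set (orientable_data @ nonorientable_data)"
  shows "M_sequence A5C2 r0 r1 r2 = hypermap_seq_of (orientable A5C2 r0 r1 r2) t"
proof -
  obtain k m n v u c where tw: "t = (k, m, n)" "w = (v, u, c)" by (metis surj_pair)
  note row = data_row[OF assms[unfolded tw]]
  show ?thesis
    by (simp add: tw M_sequence_def hypermap_seq_of_def Let_def hypermap_genus_def euler_char_def
        num_vertices_def num_hyperedges_def num_hyperfaces_def order_A5C2 row(5-10))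
qed

definition embed :: "'c \<Rightarrow> 'c \<Rightarrow> elt \<Rightarrow> (nat \<Rightarrow> nat) \<times> 'c" where
  "embed e a = (\<lambda>(p, b). (perm_fun p, if b then a else e))"

text \<open>The assumptions on \<open>a\<close> leave only the identity and \<open>a\<close> in
  \<open>C\<close>, and exclusive or of truth values matches their multiplication.\<close>

lemma embed_iso:
  assumes "group C" "a \<in> carrier C" "group.ord C a = 2" "generate C {a} = carrier C"
  shows "embed \<one>\<^bsub>C\<^esub> a \<in> iso A5C2 (alt_group 5 \<times>\<times> C)"
proof -
  interpret C: group C by fact
  have a: "a \<noteq> \<one>\<^bsub>C\<^esub>" "a \<otimes>\<^bsub>C\<^esub> a = \<one>\<^bsub>C\<^esub>"
    using C.ord_eq_2_iff assms by auto
  have C: "carrier C = {\<one>\<^bsub>C\<^esub>, a}"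
    using C.generate_involution[OF assms(2) a(2)] assms(4) by simp
  have "embed \<one>\<^bsub>C\<^esub> a ` carrier A5C2 = carrier (alt_group 5) \<times> carrier C"
  proof -
    have "embed \<one>\<^bsub>C\<^esub> a ` carrier A5C2 = perm_fun ` set A5_list \<times> {\<one>\<^bsub>C\<^esub>, a}"
      by (auto simp: embed_def image_iff)
    then show ?thesis by (simp add: C perm_fun_A5_list)
  qed
  moreover have "inj_on (embed \<one>\<^bsub>C\<^esub> a) (carrier A5C2)"
    using a(1) injD[OF inj_perm_fun] by (auto simp: inj_on_def embed_def split: if_splits)
  moreover have "embed \<one>\<^bsub>C\<^esub> a \<in> hom A5C2 (alt_group 5 \<times>\<times> C)"
    using a assms(2)
    by (auto simp: hom_def embed_def A5_list_iff alt_group_mult perm_fun_comp5)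
  ultimately show ?thesis by (simp add: Group.iso_iff)
qed

text \<open>All signs in these rows are nontrivial, so \<open>e\<close> is arbitrary. The proof also
  compares the stated sequences with those computed from the types.\<close>

lemma orientable_list_eq:
  "orientable_list a = map (\<lambda>((r0, r1, r2), t, _).
     ((embed e a r0, embed e a r1, embed e a r2), hypermap_seq_of True t)) orientable_data"
  by (simp add: orientable_list_def orientable_data_def embed_def perm_fun_ct hypermap_seq_of_def)

lemma nonorientable_list_eq:
  "nonorientable_list e a = map (\<lambda>((r0, r1, r2), t, _).
     ((embed e a r0, embed e a r1, embed e a r2), hypermap_seq_of False t)) nonorientable_data"
  by (simp add: nonorientable_list_def nonorientable_data_def embed_def perm_fun_ct hypermap_seq_of_def)

theorem theorem3p14:
  fixes C :: "'c monoid" and a :: 'c and G :: "((nat \<Rightarrow> nat) \<times> 'c) monoid"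
  assumes "group C" and "a \<in> carrier C" and "group.ord C a = 2" and "generate C {a} = carrier C"
    and "G = alt_group 5 \<times>\<times> C"
  shows "(\<forall>r0 r1 r2. regular_linear_hypermap G r0 r1 r2 \<longrightarrow>
            (orientable G r0 r1 r2 \<longrightarrow>
               (\<exists>(s, q) \<in> set (orientable_list a). hypermap_isomorphic G (r0, r1, r2) G s)) \<and>
            (\<not> orientable G r0 r1 r2 \<longrightarrow>
               (\<exists>(s, q) \<in> set (nonorientable_list \<one>\<^bsub>C\<^esub> a). hypermap_isomorphic G (r0, r1, r2) G s)))
       \<and> (\<forall>((s0, s1, s2), q) \<in> set (orientable_list a).
            regular_linear_hypermap G s0 s1 s2 \<and> orientable G s0 s1 s2 \<and> M_sequence G s0 s1 s2 = q)
       \<and> (\<forall>((s0, s1, s2), q) \<in> set (nonorientable_list \<one>\<^bsub>C\<^esub> a).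
            regular_linear_hypermap G s0 s1 s2 \<and> \<not> orientable G s0 s1 s2 \<and> M_sequence G s0 s1 s2 = q)"
proof -
  define h where "h = embed \<one>\<^bsub>C\<^esub> a"
  have h: "h \<in> iso A5C2 G"
    using embed_iso[OF assms(1-4)] by (simp add: h_def assms(5))
  interpret G: group G
    using DirProd_group[OF alt_group_is_group assms(1)] by (simp add: assms(5))
  note Qgrp = Q.group_axioms and Ggrp = G.group_axioms
  have row: "regular_linear_hypermap G (h r0) (h r1) (h r2)"
      "orientable G (h r0) (h r1) (h r2) = orientable A5C2 r0 r1 r2"
      "M_sequence G (h r0) (h r1) (h r2) = hypermap_seq_of (orientable A5C2 r0 r1 r2) t"
    if "((r0, r1, r2), t, w) \<in> set (orientable_data @ nonorientable_data)" for r0 r1 r2 t w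
  proof -
    note lin = linear_row[OF that]
    then have car: "r0 \<in> carrier A5C2" "r1 \<in> carrier A5C2" "r2 \<in> carrier A5C2"
      by (simp_all add: regular_linear_hypermap_def involution_def)
    show "regular_linear_hypermap G (h r0) (h r1) (h r2)"
      by (rule regular_linear_hypermap_iso[OF Ggrp h lin])
    show "orientable G (h r0) (h r1) (h r2) = orientable A5C2 r0 r1 r2"
      by (rule orientable_iso[OF Qgrp Ggrp h car])
    show "M_sequence G (h r0) (h r1) (h r2) = hypermap_seq_of (orientable A5C2 r0 r1 r2) t"
      using M_sequence_iso[OF Qgrp Ggrp h car] M_sequence_row[OF that] by simp
  qed
  have nonori: "\<not> orientable A5C2 r0 r1 r2"
    if "((r0, r1, r2), t, w) \<in> set nonorientable_data" for r0 r1 r2 t w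
    using nonorientable_row[OF that] by (simp add: orientable_def)
  have covered: "(orientable G r0 r1 r2 \<longrightarrow>
        (\<exists>(s, q) \<in> set (orientable_list a). hypermap_isomorphic G (r0, r1, r2) G s)) \<and>
      (\<not> orientable G r0 r1 r2 \<longrightarrow>
        (\<exists>(s, q) \<in> set (nonorientable_list \<one>\<^bsub>C\<^esub> a). hypermap_isomorphic G (r0, r1, r2) G s))"
    if rlh: "regular_linear_hypermap G r0 r1 r2" for r0 r1 r2
  proof -
    let ?g = "inv_into (carrier A5C2) h"
    have g: "?g \<in> iso G A5C2" by (rule Q.iso_set_sym[OF h])
    obtain \<sigma> where \<sigma>: "\<sigma> \<in> iso A5C2 A5C2" "(\<sigma> (?g r0), \<sigma> (?g r1), \<sigma> (?g r2)) \<in> listed"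
      using regular_linear_hypermap_classification
        regular_linear_hypermap_iso[OF Qgrp g rlh] by blast
    \<comment> \<open>Pull back to the model, classify there, and return: an automorphism of
      \<open>G\<close> that takes the given triple to a listed one.\<close>
    define \<tau> where "\<tau> = h \<circ> (\<sigma> \<circ> ?g)"
    have \<tau>: "\<tau> \<in> iso G G"
      unfolding \<tau>_def by (intro iso_set_trans[OF _ h] iso_set_trans[OF g \<sigma>(1)])
    have car: "r0 \<in> carrier G" "r1 \<in> carrier G" "r2 \<in> carrier G"
      using rlh by (simp_all add: regular_linear_hypermap_def involution_def)
    have iso: "hypermap_isomorphic G (r0, r1, r2) G (\<tau> r0, \<tau> r1, \<tau> r2)"
      by (rule hypermap_isomorphic_iso[OF \<tau> car])
    \<comment> \<open>Invariance of orientability decides which of the two lists contains the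
      image.\<close>
    have ori: "orientable G (\<tau> r0) (\<tau> r1) (\<tau> r2) = orientable G r0 r1 r2"
      by (rule orientable_iso[OF Ggrp Ggrp \<tau> car])
    define t0 t1 t2 where t: "t0 = \<sigma> (?g r0)" "t1 = \<sigma> (?g r1)" "t2 = \<sigma> (?g r2)"
    then have \<tau>_eq: "\<tau> r0 = h t0" "\<tau> r1 = h t1" "\<tau> r2 = h t2"
      by (simp_all add: \<tau>_def)
    obtain u w where "((t0, t1, t2), u, w) \<in> set (orientable_data @ nonorientable_data)"
      using \<sigma>(2) by (auto simp only: t elim: listedE)
    then consider "((t0, t1, t2), u, w) \<in> set orientable_data"
      | "((t0, t1, t2), u, w) \<in> set nonorientable_data" by auto
    then show ?thesis
    proof cases
      case 1
      then have "((\<tau> r0, \<tau> r1, \<tau> r2), hypermap_seq_of True u) \<in> set (orientable_list a)"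
        by (force simp: orientable_list_eq[of a "\<one>\<^bsub>C\<^esub>"] \<tau>_eq h_def)
      moreover have "orientable G r0 r1 r2"
        using row(2)[of t0 t1 t2 u w] 1 orientable_row(1)[OF 1] ori by (simp add: \<tau>_eq)
      ultimately show ?thesis using iso by blast
    next
      case 2
      then have "((\<tau> r0, \<tau> r1, \<tau> r2), hypermap_seq_of False u) \<in> set (nonorientable_list \<one>\<^bsub>C\<^esub> a)"
        by (force simp: nonorientable_list_eq \<tau>_eq h_def)
      moreover have "\<not> orientable G r0 r1 r2"
        using row(2)[of t0 t1 t2 u w] 2 nonori[OF 2] ori by (simp add: \<tau>_eq)
      ultimately show ?thesis using iso by blast
    qed
  qed
  have "\<forall>((s0, s1, s2), q) \<in> set (orientable_list a).
      regular_linear_hypermap G s0 s1 s2 \<and> orientable G s0 s1 s2 \<and> M_sequence G s0 s1 s2 = q"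
    unfolding orientable_list_eq[of a "\<one>\<^bsub>C\<^esub>"] h_def[symmetric]
    using row orientable_row(1) by fastforce
  moreover have "\<forall>((s0, s1, s2), q) \<in> set (nonorientable_list \<one>\<^bsub>C\<^esub> a).
      regular_linear_hypermap G s0 s1 s2 \<and> \<not> orientable G s0 s1 s2 \<and> M_sequence G s0 s1 s2 = q"
    unfolding nonorientable_list_eq h_def[symmetric]
    using row nonori by fastforce
  ultimately show ?thesis using covered by blast
qed

end
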